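(* Let the sequence $\{(U^{(j)},V^{(j)})\}_{j=0}^\infty$ be generated by the NPDo iteration with Gauss-Seidel-type updating: $(U^{(0)},V^{(0)})\in\mathrm{St}(k,n_1)\times\mathrm{St}(k,n_2)$ is given and, for $j=0,1,2,\dots$, $U^{(j+1)}$ is an orthonormal polar factor of $\mathscr{H}_1(U^{(j)},V^{(j)})$ and then $V^{(j+1)}$ is an orthonormal polar factor of $\mathscr{H}_2(U^{(j+1)},V^{(j)})$. Write $\mathscr{H}_1^{(j)}=\mathscr{H}_1(U^{(j)},V^{(j)})$ and $\widehat{\mathscr{H}}_2^{(j)}=\mathscr{H}_2(U^{(j+1)},V^{(j)})$. The following statements hold. (a) The sequence $\{f(U^{(j)},V^{(j)})\}_{j=0}^\infty$ is monotonically increasing (i.e., nondecreasing) and convergent. (b) Let $(U_*,V_* )$ be an accumulation point of $\{(U^{(j)},V^{(j)})\}_{j=0}^\infty$, and let $\{(U^{(j)},V^{(j)})\}_{j\in\mathbb{I}}$ be a subsequence that converges to $(U_*,V_* )$. Then $$\mathscr{H}_1(U_*,V_* )=U_*\Lambda_{1*},\quad \Lambda_{1*}=U_*^{\mathrm H}\mathscr{H}_1(U_*,V_* )\succeq 0,$$ $$\mathscr{H}_2(\widehat U_*,V_* )=V_*\Lambda_{2*},\quad \Lambda_{2*}=V_*^{\mathrm H}\mathscr{H}_2(\widehat U_*,V_* )\succeq 0,$$ where $\widehat U_*$ is any accumulation point of $\{U^{(j+1)}\}_{j\in\mathbb{I}}$. As a result, if also $\widehat U_*=U_*$, then $$\mathscr{H}_1(U_*,V_*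 )=U_*\Lambda_{1*},\ \Lambda_{1*}=U_*^{\mathrm H}\mathscr{H}_1(U_*,V_* )\succeq 0,\qquad \mathscr{H}_2(U_*,V_* )=V_*\Lambda_{2*},\ \Lambda_{2*}=V_*^{\mathrm H}\mathscr{H}_2(U_*,V_* )\succeq 0. \quad (\star)$$ (c) In item (b), if $\operatorname{rank}(\mathscr{H}_1(U_*,V_* ))=k$, then $\widehat U_*=U_*$ and hence $(\star)$ holds. (d) If $(U_*,V_* )$ is an isolated accumulation point of $\{(U^{(j)},V^{(j)})\}_{j=0}^\infty$ and if $\operatorname{rank}(\mathscr{H}_i(U_*,V_* ))=k$ for $i=1,2$, then the entire sequence $\{(U^{(j)},V^{(j)})\}_{j=0}^\infty$ converges to $(U_*,V_* )$. (e) The following four series converge: $$\sum_{j=0}^\infty\sigma_{\min}(\mathscr{H}_1^{(j)})\,\big\|\sin\Theta\big(\mathcal{R}(U^{(j+1)}),\mathcal{R}(U^{(j)})\big)\big\|_{\mathrm F}^2<\infty,$$ $$\sum_{j=0}^\infty\sigma_{\min}(\widehat{\mathscr{H}}_2^{(j)})\,\big\|\sin\Theta\big(\mathcal{R}(V^{(j+1)}),\mathcal{R}(V^{(j)})\big)\big\|_{\mathrm F}^2<\infty,$$ $$\sum_{j=0}^\infty\sigma_{\min}(\mathscr{H}_1^{(j)})\,\frac{\big\|\mathscr{H}_1^{(j)}-U^{(j)}\big([U^{(j)}]^{\mathrm H}\mathscr{H}_1^{(j)}\big)\big\|_{\mathrm F}^2}{\|\mathscr{H}_1^{(j)}\|_{\mathrm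 F}^2}<\infty,$$ $$\sum_{j=0}^\infty\sigma_{\min}(\widehat{\mathscr{H}}_2^{(j)})\,\frac{\big\|\widehat{\mathscr{H}}_2^{(j)}-V^{(j)}\big([V^{(j)}]^{\mathrm H}\widehat{\mathscr{H}}_2^{(j)}\big)\big\|_{\mathrm F}^2}{\|\widehat{\mathscr{H}}_2^{(j)}\|_{\mathrm F}^2}<\infty.$$
   Context: Let $B_\ell\in\mathbb{C}^{n_1\times n_2}$, $1\le\ell\le N$, be given matrices, and let $\tau_k=(k_1,\dots,k_t)$ be a partition of $k$: integers $k_i\ge1$ with $k=\sum_{i=1}^t k_i\le\min\{n_1,n_2\}$. $\mathrm{St}(k,n)=\{P\in\mathbb{C}^{n\times k}:P^{\mathrm H}P=I_k\}$ is the complex Stiefel manifold, where $X^{\mathrm H}$ denotes the conjugate transpose. For a $k\times k$ matrix $A$ with blocks $A_{ij}\in\mathbb{C}^{k_i\times k_j}$, $\mathrm{BDiag}_{\tau_k}(A)=\operatorname{diag}(A_{11},\dots,A_{tt})$. The problem is to maximize over $\mathrm{St}(k,n_1)\times\mathrm{St}(k,n_2)$ the objective $$f(U,V)=\sum_{\ell=1}^N\|\mathrm{BDiag}_{\tau_k}(U^{\mathrm H}B_\ell V)\|_{\mathrm F}^2 .$$ Partition columnwise $U=[U_1,\dots,U_t]$, $V=[V_1,\dots,V_t]$ with $U_i,V_i$ having $k_i$ columns. The partial Euclidean gradients $\mathscr{H}_1=\nabla_Uf$, $\mathscr{H}_2=\nabla_Vf$ (with respect to $\langle X,Y\rangle=\Re\operatorname{tr}(Y^{\mathrm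 H}X)$) are $$\mathscr{H}_1(U,V)=2\sum_{\ell=1}^N\big[B_\ell V_1V_1^{\mathrm H}B_\ell^{\mathrm H}U_1,\dots,B_\ell V_tV_t^{\mathrm H}B_\ell^{\mathrm H}U_t\big],$$ $$\mathscr{H}_2(U,V)=2\sum_{\ell=1}^N\big[B_\ell^{\mathrm H}U_1U_1^{\mathrm H}B_\ell V_1,\dots,B_\ell^{\mathrm H}U_tU_t^{\mathrm H}B_\ell V_t\big].$$ An orthonormal polar factor of $H\in\mathbb{C}^{n\times k}$ ($k\le n$) is a $P\in\mathrm{St}(k,n)$ such that $H=P\Lambda$ with $\Lambda$ Hermitian positive semidefinite (it is unique if $\operatorname{rank}H=k$; otherwise any choice is allowed). The iteration is run indefinitely (no stopping). Notation: $\succeq 0$ means Hermitian positive semidefinite; $\sigma_{\min}(H)$ is the smallest of the $\min\{n,k\}$ singular values of $H\in\mathbb{C}^{n\times k}$; $\mathcal{R}(X)$ is the column space of $X$; $\Theta(\mathcal{X},\mathcal{Y})$ is the diagonal matrix of canonical (principal) angles between two subspaces of equal dimension, and $\sin\Theta$ is taken entrywise on the diagonal. In the series, a term whose factor $\sigma_{\min}(\cdot)$ is $0$ is read as $0$. *)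

theory Defs
  imports "HOL-Analysis.Analysis"
begin

text \<open>
  An \<open>n \<times> k\<close> complex matrix is an element of \<^typ>\<open>complex^'k^'n\<close>. The library's \<open>norm\<close> on this
  type is the Frobenius norm, and its inner product is \<open>X \<bullet> Y = Re tr (Y\<^sup>H X)\<close>.
  The column index type \<^typ>\<open>'k\<close> is linearly ordered, so that one can speak of its first
  \<open>k\<^sub>1\<close> columns, its next \<open>k\<^sub>2\<close> columns, etc.
\<close>

definition ctranspose :: "complex^'k^'n \<Rightarrow> complex^'n^'k" where
  "ctranspose A = (\<chi> i j. cnj (A $ j $ i))"

definition hpsd :: "complex^'n^'n \<Rightarrow> bool" where
  "hpsd A \<longleftrightarrow> ctranspose A = A \<and> (\<forall>x. 0 \<le> Re (\<Sum>i\<in>UNIV. cnj (x $ i) * (A *v x) $ i))"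

definition stiefel :: "(complex^'k^'n) set" where
  "stiefel = {P. ctranspose P ** P = mat 1}"

definition polar_factor :: "complex^'k^'n \<Rightarrow> complex^'k^'n \<Rightarrow> bool" where
  "polar_factor H P \<longleftrightarrow> P \<in> stiefel \<and> (\<exists>\<Lambda>. hpsd \<Lambda> \<and> H = P ** \<Lambda>)"

definition col_space :: "complex^'k^'n \<Rightarrow> (complex^'n) set" where
  "col_space A = vec.span (columns A)"


subsection \<open>Partitions and blocks\<close>

definition partition_of :: "nat list \<Rightarrow> nat \<Rightarrow> bool" where
  "partition_of \<tau> k \<longleftrightarrow> (\<forall>m\<in>set \<tau>. 1 \<le> m) \<and> sum_list \<tau> = k"

text \<open>Zero-based position of an index in the increasing enumeration of its type.\<close>

definition pos :: "'k::{finite,linorder} \<Rightarrow> nat" where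
  "pos c = card {d. d < c}"

text \<open>Blocks are numbered from \<open>0\<close>.\<close>

definition in_block :: "nat list \<Rightarrow> nat \<Rightarrow> 'k::{finite,linorder} \<Rightarrow> bool" where
  "in_block \<tau> i c \<longleftrightarrow> sum_list (take i \<tau>) \<le> pos c \<and> pos c < sum_list (take (Suc i) \<tau>)"

definition bdiag :: "nat list \<Rightarrow> complex^'k::{finite,linorder}^'k::{finite,linorder} \<Rightarrow> complex^'k::{finite,linorder}^'k::{finite,linorder}" where
  "bdiag \<tau> A = (\<chi> a b. if \<exists>i<length \<tau>. in_block \<tau> i a \<and> in_block \<tau> i b then A $ a $ b else 0)"

text \<open>
  The block of columns \<open>X\<^sub>i\<close> of \<open>X = [X\<^sub>1, \<dots>, X\<^sub>t]\<close> is kept at full width, with zeros in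
  the columns of the other blocks. Hence \<open>col_block \<tau> i X ** ctranspose (col_block \<tau> i X)\<close> is
  \<open>X\<^sub>i X\<^sub>i\<^sup>H\<close>, and \<open>[M\<^sub>1 X\<^sub>1, \<dots>, M\<^sub>t X\<^sub>t]\<close> is \<open>\<Sum>i<t. M\<^sub>i ** col_block \<tau> i X\<close>.
\<close>

definition col_block ::
    "nat list \<Rightarrow> nat \<Rightarrow> complex^'k::{finite,linorder}^'n \<Rightarrow> complex^'k::{finite,linorder}^'n" where
  "col_block \<tau> i X = (\<chi> a c. if in_block \<tau> i c then X $ a $ c else 0)"

definition objective ::
    "nat list \<Rightarrow> nat \<Rightarrow> (nat \<Rightarrow> complex^'n2^'n1) \<Rightarrow>
     complex^'k::{finite,linorder}^'n1 \<Rightarrow> complex^'k::{finite,linorder}^'n2 \<Rightarrow> real" where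
  "objective \<tau> N B U V = (\<Sum>l=1..N. (norm (bdiag \<tau> (ctranspose U ** B l ** V)))\<^sup>2)"

definition grad_U ::
    "nat list \<Rightarrow> nat \<Rightarrow> (nat \<Rightarrow> complex^'n2^'n1) \<Rightarrow>
     complex^'k::{finite,linorder}^'n1 \<Rightarrow> complex^'k::{finite,linorder}^'n2 \<Rightarrow> complex^'k::{finite,linorder}^'n1" where
  "grad_U \<tau> N B U V = 2 *\<^sub>R (\<Sum>l=1..N. \<Sum>i<length \<tau>.
     B l ** col_block \<tau> i V ** ctranspose (col_block \<tau> i V) ** ctranspose (B l) ** col_block \<tau> i U)"

definition grad_V ::
    "nat list \<Rightarrow> nat \<Rightarrow> (nat \<Rightarrow> complex^'n2^'n1) \<Rightarrow>
     complex^'k::{finite,linorder}^'n1 \<Rightarrow> complex^'k::{finite,linorder}^'n2 \<Rightarrow> complex^'k::{finite,linorder}^'n2" where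
  "grad_V \<tau> N B U V = 2 *\<^sub>R (\<Sum>l=1..N. \<Sum>i<length \<tau>.
     ctranspose (B l) ** col_block \<tau> i U ** ctranspose (col_block \<tau> i U) ** B l ** col_block \<tau> i V)"


subsection \<open>\<^const>\<open>grad_U\<close> and \<^const>\<open>grad_V\<close> are the partial gradients of the objective\<close>

lemma ctranspose_mult: "ctranspose (A ** B) = ctranspose B ** ctranspose A"
  by (simp add: ctranspose_def matrix_matrix_mult_def vec_eq_iff mult.commute)

lemma ctranspose_ctranspose [simp]: "ctranspose (ctranspose A) = A"
  by (simp add: ctranspose_def vec_eq_iff)

lemma inner_matrix: "X \<bullet> Y = Re (\<Sum>i\<in>UNIV. \<Sum>j\<in>UNIV. X $ i $ j * cnj (Y $ i $ j))"
  for X Y :: "complex^'k^'n"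
  by (simp add: inner_vec_def inner_complex_def)

lemma inner_matrix_shift: "X \<bullet> (ctranspose h ** W) = h \<bullet> (W ** ctranspose X)"
proof -
  have "(\<Sum>i\<in>UNIV. \<Sum>j\<in>UNIV. cnj (X $ i $ j) * (\<Sum>a\<in>UNIV. cnj (h $ a $ i) * W $ a $ j))
      = (\<Sum>i\<in>UNIV. \<Sum>j\<in>UNIV. \<Sum>a\<in>UNIV. cnj (h $ a $ i) * W $ a $ j * cnj (X $ i $ j))"
    by (simp add: sum_distrib_left mult_ac)
  also have "\<dots> = (\<Sum>i\<in>UNIV. \<Sum>a\<in>UNIV. \<Sum>j\<in>UNIV. cnj (h $ a $ i) * W $ a $ j * cnj (X $ i $ j))"
    by (intro sum.cong sum.swap refl)
  also have "\<dots> = (\<Sum>a\<in>UNIV. \<Sum>i\<in>UNIV. cnj (h $ a $ i) * (\<Sum>j\<in>UNIV. W $ a $ j * cnj (X $ i $ j)))"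
    by (subst sum.swap) (simp add: sum_distrib_left mult_ac)
  finally have e: "(\<Sum>i\<in>UNIV. \<Sum>j\<in>UNIV. cnj (X $ i $ j) * (\<Sum>a\<in>UNIV. cnj (h $ a $ i) * W $ a $ j))
     = (\<Sum>a\<in>UNIV. \<Sum>i\<in>UNIV. cnj (h $ a $ i) * (\<Sum>j\<in>UNIV. W $ a $ j * cnj (X $ i $ j)))" .
  have c: "Y \<bullet> Z = Re (\<Sum>i\<in>UNIV. \<Sum>j\<in>UNIV. cnj (Y $ i $ j) * Z $ i $ j)" for Y Z :: "complex^'x^'y"
    by (simp add: inner_vec_def inner_complex_def)
  show ?thesis unfolding c using e by (simp add: ctranspose_def matrix_matrix_mult_def)
qed

lemma in_block_unique:
  assumes "in_block \<tau> i c" "in_block \<tau> j c" shows "i = j"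
proof -
  have m: "sum_list (take a \<tau>) \<le> sum_list (take b \<tau>)" if "a \<le> b" for a b
    using that by (metis add.commute le_add1 le_add_diff_inverse sum_list_append take_add)
  have "\<not> i < j" "\<not> j < i"
    using assms m[of "Suc i" j] m[of "Suc j" i] unfolding in_block_def
    by (auto simp: Suc_le_eq simp del: take_Suc)
  then show ?thesis by simp
qed

lemma bdiag_mult:
  "bdiag \<tau> (ctranspose X ** Y) = (\<Sum>i<length \<tau>. ctranspose (col_block \<tau> i X) ** col_block \<tau> i Y)"
proof -
  have "(\<Sum>i<length \<tau>. ctranspose (col_block \<tau> i X) ** col_block \<tau> i Y) $ a $ b
     = bdiag \<tau> (ctranspose X ** Y) $ a $ b" for a b
  proof -
    have 1: "(\<Sum>i<length \<tau>. ctranspose (col_block \<tau> i X) ** col_block \<tau> i Y) $ a $ b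
      = (\<Sum>i<length \<tau>. if in_block \<tau> i a \<and> in_block \<tau> i b then (ctranspose X ** Y) $ a $ b else 0)"
      by (auto simp: matrix_matrix_mult_def ctranspose_def col_block_def intro!: sum.cong)
    show ?thesis
    proof (cases "\<exists>i<length \<tau>. in_block \<tau> i a \<and> in_block \<tau> i b")
      case True
      then obtain i where i: "i<length \<tau>" "in_block \<tau> i a" "in_block \<tau> i b" by blast
      then have "(in_block \<tau> j a \<and> in_block \<tau> j b) = (j = i)" for j using in_block_unique by blast
      with i show ?thesis unfolding 1 by (auto simp: bdiag_def)
    next
      case False
      then have "bdiag \<tau> (ctranspose X ** Y) $ a $ b = 0" by (auto simp: bdiag_def)
      with False show ?thesis unfolding 1 by (auto intro!: sum.neutral)
    qed
  qed
  then show ?thesis by (simp add: vec_eq_iff)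
qed

lemma col_block_mult: "A ** col_block \<tau> i X = col_block \<tau> i (A ** X)"
  by (auto simp: vec_eq_iff matrix_matrix_mult_def col_block_def)

lemma inner_bdiag: "bdiag \<tau> A \<bullet> bdiag \<tau> C = bdiag \<tau> A \<bullet> C"
  by (auto simp: inner_vec_def bdiag_def intro!: sum.cong)

lemma inner_col_block: "col_block \<tau> i X \<bullet> Y = X \<bullet> col_block \<tau> i Y"
  by (auto simp: inner_vec_def col_block_def intro!: sum.cong)

lemma matrix_sum_right: "C ** (\<Sum>i\<in>S. F i) = (\<Sum>i\<in>S. C ** F i)"
  for C :: "complex^'a^'b"
  by (induction S rule: infinite_finite_induct) (auto simp: matrix_add_ldistrib)
lemma ctranspose_sum: "ctranspose (\<Sum>i\<in>S. F i) = (\<Sum>i\<in>S. ctranspose (F i))"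
  by (simp add: ctranspose_def vec_eq_iff)

lemma linear_bd: "linear (\<lambda>X. bdiag \<tau> (ctranspose X ** W))"
  by (auto simp: linear_iff bdiag_def ctranspose_def matrix_matrix_mult_def vec_eq_iff 
     sum.distrib algebra_simps scaleR_sum_right)

lemma col_block_inner_eq: "bdiag \<tau> (ctranspose U ** W) \<bullet> bdiag \<tau> (ctranspose h ** W) =
   h \<bullet> (\<Sum>i<length \<tau>. col_block \<tau> i W ** ctranspose (col_block \<tau> i W) ** col_block \<tau> i U)"
proof -
  have *: "W ** (ctranspose (col_block \<tau> i W) ** col_block \<tau> i U) =
     col_block \<tau> i W ** (ctranspose (col_block \<tau> i W) ** col_block \<tau> i U)" for i
    by (auto simp: vec_eq_iff matrix_matrix_mult_def col_block_def ctranspose_def intro!: sum.cong)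
  show ?thesis
    unfolding inner_bdiag inner_matrix_shift
    unfolding bdiag_mult ctranspose_sum ctranspose_mult ctranspose_ctranspose matrix_sum_right *
    by (simp add: matrix_mul_assoc)
qed

lemma has_gradient_U: "GDERIV (\<lambda>X. objective \<tau> N B X V) U :> grad_U \<tau> N B U V"
proof -
  define T where "T l X = bdiag \<tau> (ctranspose X ** (B l ** V))" for l and X
  have T: "(T l has_derivative T l) (at U)" for l
    unfolding T_def by (intro linear_imp_has_derivative linear_bd)
  have "((\<lambda>X. \<Sum>l=1..N. T l X \<bullet> T l X) has_derivative
     (\<lambda>h. \<Sum>l=1..N. T l U \<bullet> T l h + T l h \<bullet> T l U)) (at U)"
    by (intro has_derivative_sum has_derivative_inner T)
  moreover have "(\<lambda>X. \<Sum>l=1..N. T l X \<bullet> T l X) = (\<lambda>X. objective \<tau> N B X V)"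
    by (simp add: objective_def T_def power2_norm_eq_inner matrix_mul_assoc)
  moreover have "(\<lambda>h. \<Sum>l=1..N. T l U \<bullet> T l h + T l h \<bullet> T l U) = (\<lambda>h. h \<bullet> grad_U \<tau> N B U V)"
  proof
    fix h
    have "T l U \<bullet> T l h + T l h \<bullet> T l U = h \<bullet> (2 *\<^sub>R (\<Sum>i<length \<tau>. B l ** col_block \<tau> i V ** ctranspose (col_block \<tau> i V) ** ctranspose (B l) ** col_block \<tau> i U))" for l
      unfolding inner_commute[of "T l h"] unfolding T_def col_block_inner_eq 
      by (simp add: col_block_mult[symmetric] ctranspose_mult matrix_mul_assoc)
    then show "(\<Sum>l=1..N. T l U \<bullet> T l h + T l h \<bullet> T l U) = h \<bullet> grad_U \<tau> N B U V"
      by (simp only: grad_U_def inner_sum_right scaleR_sum_right)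
  qed
  ultimately show ?thesis by (simp add: gderiv_def)
qed

lemma norm_ct: "norm (ctranspose A) = norm A"
proof -
  have "ctranspose A \<bullet> ctranspose A = A \<bullet> A"
    unfolding inner_matrix by (subst sum.swap) (simp add: ctranspose_def mult.commute)
  then show ?thesis by (simp add: norm_eq)
qed

lemma bdiag_ct: "bdiag \<tau> (ctranspose A) = ctranspose (bdiag \<tau> A)"
  by (auto simp: bdiag_def ctranspose_def vec_eq_iff)

lemma objective_swap: "objective \<tau> N B U V = objective \<tau> N (\<lambda>l. ctranspose (B l)) V U"
proof -
  have "norm (bdiag \<tau> (ctranspose V ** ctranspose (B l) ** U)) = norm (bdiag \<tau> (ctranspose U ** B l ** V))" for l
    by (subst norm_ct[symmetric]) (simp add: bdiag_ct[symmetric] ctranspose_mult matrix_mul_assoc)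
  then show ?thesis by (simp add: objective_def)
qed

lemma has_gradient_V: "GDERIV (\<lambda>Y. objective \<tau> N B U Y) V :> grad_V \<tau> N B U V"
proof -
  have "grad_V \<tau> N B U V = grad_U \<tau> N (\<lambda>l. ctranspose (B l)) V U"
    by (simp add: grad_U_def grad_V_def)
  then show ?thesis using has_gradient_U[of \<tau> N "\<lambda>l. ctranspose (B l)" U V]
    by (simp add: objective_swap[of \<tau> N B U])
qed


subsection \<open>Singular values and canonical angles\<close>

definition char_polynomial :: "complex^'n^'n \<Rightarrow> complex poly" where
  "char_polynomial A = det (\<chi> i j. (if i = j then [:0, 1:] else 0) - [:A $ i $ j:])"

text \<open>
  The \<open>min {n, k}\<close> singular values in decreasing order, with multiplicity: the square roots of
  the eigenvalues of the smaller one of the two Gram matrices.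
\<close>

definition singular_values :: "complex^'k^'n \<Rightarrow> real list" where
  "singular_values A = rev (sorted_list_of_multiset (image_mset (\<lambda>z. sqrt (Re z))
     (if CARD('k) \<le> CARD('n) then proots (char_polynomial (ctranspose A ** A))
      else proots (char_polynomial (A ** ctranspose A)))))"

definition sigma_min :: "complex^'k^'n \<Rightarrow> real" where
  "sigma_min A = Min (set (singular_values A))"

definition orthonormal_basis_matrix :: "(complex^'n) set \<Rightarrow> complex^'k^'n" where
  "orthonormal_basis_matrix S = (SOME P. P \<in> stiefel \<and> col_space P = S)"

text \<open>
  \<open>\<Theta>(S, T)\<close> for subspaces \<open>S\<close>, \<open>T\<close> of the common dimension \<open>k\<close>: the diagonal matrix of the
  angles whose cosines are the singular values of \<open>P\<^sup>H Q\<close>, where the columns of \<open>P\<close> and \<open>Q\<close> form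
  orthonormal bases of \<open>S\<close> and \<open>T\<close> (these singular values do not depend on the bases).
  The dimension is determined by the result type.
\<close>

definition canonical_angles ::
    "(complex^'n) set \<Rightarrow> (complex^'n) set \<Rightarrow> real^'k::{finite,linorder}^'k::{finite,linorder}" where
  "canonical_angles S T =
     (let P = orthonormal_basis_matrix S :: complex^'k::{finite,linorder}^'n;
          Q = orthonormal_basis_matrix T :: complex^'k::{finite,linorder}^'n
      in \<chi> a b. if a = b then arccos (singular_values (ctranspose P ** Q) ! pos a) else 0)"

definition sin_diag :: "real^'k^'k \<Rightarrow> real^'k^'k" where
  "sin_diag \<Theta> = (\<chi> a b. if a = b then sin (\<Theta> $ a $ a) else 0)"


subsection \<open>Accumulation points and the iteration\<close>

definition accumulation_point :: "(nat \<Rightarrow> 'a::topological_space) \<Rightarrow> 'a \<Rightarrow> bool" where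
  "accumulation_point X x \<longleftrightarrow> (\<exists>r::nat \<Rightarrow> nat. strict_mono r \<and> (X \<circ> r) \<longlonglongrightarrow> x)"

text \<open>
  A polar factor is not unique if the gradient is rank deficient, so the iteration is a
  relation: any admissible choice is allowed in each step.
\<close>

definition npdo_gauss_seidel ::
    "nat list \<Rightarrow> nat \<Rightarrow> (nat \<Rightarrow> complex^'n2^'n1) \<Rightarrow>
     (nat \<Rightarrow> complex^'k::{finite,linorder}^'n1) \<Rightarrow> (nat \<Rightarrow> complex^'k::{finite,linorder}^'n2) \<Rightarrow> bool" where
  "npdo_gauss_seidel \<tau> N B U V \<longleftrightarrow>
     U 0 \<in> stiefel \<and> V 0 \<in> stiefel \<and>
     (\<forall>j. polar_factor (grad_U \<tau> N B (U j) (V j)) (U (Suc j)) \<and>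
          polar_factor (grad_V \<tau> N B (U (Suc j)) (V j)) (V (Suc j)))"

text \<open>\<open>H = P \<Lambda>\<close> with \<open>\<Lambda> = P\<^sup>H H\<close> positive semidefinite.\<close>

definition polar_equation :: "complex^'k^'n \<Rightarrow> complex^'k^'n \<Rightarrow> bool" where
  "polar_equation H P \<longleftrightarrow> H = P ** (ctranspose P ** H) \<and> hpsd (ctranspose P ** H)"

end

theory Submission
  imports Defs "HOL-Computational_Algebra.Fundamental_Theorem_Algebra"
begin

text \<open>
  For fixed \<open>V\<close> the objective is a convex quadratic form in \<open>U\<close>, so one half-step from \<open>Q\<close> to a
  polar factor \<open>P\<close> of the gradient \<open>H = P \<Lambda>\<close> increases it by at least the gap
  \<open>H \<bullet> P - H \<bullet> Q = (P - Q) \<bullet> ((P - Q) \<Lambda>) / 2 \<ge> 0\<close>. The objective is bounded, so the gaps are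
  summable. In the limit along a subsequence the gap vanishes, and since \<open>\<Lambda>\<close> is positive
  semidefinite this forces \<open>(P - Q) \<Lambda> = 0\<close>: then \<open>Q\<close> also is a polar factor of \<open>H\<close>, and \<open>P = Q\<close>
  if \<open>H\<close> has full rank. For the series, the gap is at least \<open>\<sigma>\<^sub>m\<^sub>i\<^sub>n(H) \<parallel>P - Q\<parallel>\<^sup>2 / 2\<close>, because the
  smallest eigenvalue of \<open>\<Lambda>\<close> is a singular value of \<open>H\<close>, while \<open>\<parallel>P - Q\<parallel>\<close> bounds the sines of the
  canonical angles and the relative residual.
\<close>


subsection \<open>Hermitian forms of complex matrices\<close>

lemma matrix_diff_ldistrib: "A ** (B - C) = A ** B - A ** C" for A :: "complex^'b^'a"
  by (simp add: matrix_matrix_mult_def vec_eq_iff algebra_simps sum_subtractf)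

lemma matrix_diff_rdistrib: "(B - C) ** A = B ** A - C ** A" for A :: "complex^'b^'a"
  by (simp add: matrix_matrix_mult_def vec_eq_iff algebra_simps sum_subtractf)

lemma inner_ctranspose: "ctranspose X \<bullet> ctranspose Y = X \<bullet> Y"
  unfolding inner_matrix by (subst sum.swap) (simp add: ctranspose_def mult.commute)

text \<open>Adjointness of left multiplication: \<open>inner_matrix_shift\<close> is applied twice,
  with a conjugate transposition of both arguments in between.\<close>

lemma inner_mult_left: "(A ** X) \<bullet> Y = X \<bullet> (ctranspose A ** Y)"
proof -
  have "(A ** X) \<bullet> Y = Y \<bullet> (ctranspose (ctranspose A) ** X)"
    by (simp add: inner_commute)
  also have "\<dots> = ctranspose A \<bullet> (X ** ctranspose Y)"
    by (rule inner_matrix_shift)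
  also have "\<dots> = A \<bullet> (Y ** ctranspose X)"
    by (subst inner_ctranspose[symmetric]) (simp add: ctranspose_mult)
  also have "\<dots> = X \<bullet> (ctranspose A ** Y)"
    by (rule inner_matrix_shift[symmetric])
  finally show ?thesis .
qed

lemma inner_mult_right: "(X ** A) \<bullet> Y = X \<bullet> (Y ** ctranspose A)"
proof -
  have "(X ** A) \<bullet> Y = (ctranspose A ** ctranspose X) \<bullet> ctranspose Y"
    by (simp add: inner_ctranspose flip: ctranspose_mult)
  also have "\<dots> = ctranspose X \<bullet> ctranspose (Y ** ctranspose A)"
    by (simp add: inner_mult_left ctranspose_mult)
  finally show ?thesis by (simp add: inner_ctranspose)
qed

lemma linear_matrix_vector: "linear ((*v) A)" for A :: "complex^'k^'n"
  by (auto simp: linear_iff matrix_vector_mult_def vec_eq_iff scaleR_sum_right sum.distrib algebra_simps)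

lemma inner_matrix_vector: "(A *v x) \<bullet> y = x \<bullet> (ctranspose A *v y)"
  for A :: "complex^'k^'n"
proof -
  have "(A *v x) \<bullet> y = Re (\<Sum>i\<in>UNIV. \<Sum>j\<in>UNIV. A $ i $ j * x $ j * cnj (y $ i))"
    by (simp add: inner_vec_def inner_complex_def matrix_vector_mult_def sum_distrib_right algebra_simps)
      (simp add: sum.distrib sum_subtractf sum_distrib_left algebra_simps)
  also have "\<dots> = Re (\<Sum>j\<in>UNIV. \<Sum>i\<in>UNIV. A $ i $ j * x $ j * cnj (y $ i))"
    by (subst sum.swap) simp
  also have "\<dots> = x \<bullet> (ctranspose A *v y)"
    by (simp add: inner_vec_def inner_complex_def matrix_vector_mult_def ctranspose_def algebra_simps)
      (simp add: sum.distrib sum_subtractf sum_distrib_left algebra_simps)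
  finally show ?thesis .
qed

lemma norm_matrix_vector_le: "norm (A *v x) \<le> norm A * norm x" for A :: "complex^'k^'n"
proof -
  have "norm ((A *v x) $ i) \<le> norm (A $ i) * norm x" for i
  proof -
    have "norm ((A *v x) $ i) \<le> (\<Sum>j\<in>UNIV. \<bar>norm (A $ i $ j)\<bar> * \<bar>norm (x $ j)\<bar>)"
      unfolding matrix_vector_mult_def by (simp add: order.trans[OF norm_sum] norm_mult)
    also have "\<dots> \<le> norm (A $ i) * norm x"
      unfolding norm_vec_def by (rule L2_set_mult_ineq)
    finally show ?thesis .
  qed
  then have "norm (A *v x) \<le> L2_set (\<lambda>i. norm (A $ i) * norm x) UNIV"
    unfolding norm_vec_def[of "A *v x"] by (intro L2_set_mono) auto
  also have "\<dots> = norm A * norm x"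
    by (simp add: norm_vec_def[of A] L2_set_left_distrib)
  finally show ?thesis .
qed

lemma inner_columns: "X \<bullet> Y = (\<Sum>j\<in>UNIV. column j X \<bullet> column j Y)"
  for X Y :: "complex^'k^'n"
  unfolding inner_vec_def column_def by (subst sum.swap) simp

lemma column_matrix_mult: "column j (A ** X) = A *v column j X"
  by (simp add: column_def matrix_matrix_mult_def matrix_vector_mult_def)

text \<open>Right multiplication by a Hermitian \<open>\<Lambda>\<close> acts on each row of
  \<open>X\<close> separately, so the matrix form is a sum of vector forms over the columns of
  \<open>ctranspose X\<close>. Bounds for \<open>\<Lambda>\<close> on vectors thus carry over to
  matrices.\<close>

lemma inner_form_columns:
  assumes "ctranspose \<Lambda> = \<Lambda>"
  shows "X \<bullet> (X ** \<Lambda>) = (\<Sum>j\<in>UNIV. column j (ctranspose X) \<bullet> (\<Lambda> *v column j (ctranspose X)))"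
proof -
  have "X \<bullet> (X ** \<Lambda>) = ctranspose X \<bullet> (\<Lambda> ** ctranspose X)"
    by (subst inner_ctranspose[symmetric]) (simp add: ctranspose_mult assms)
  then show ?thesis by (simp add: inner_columns column_matrix_mult)
qed

lemma norm_matrix_mult_le: "norm (X ** Y) \<le> norm X * norm Y" for X :: "complex^'k^'n"
proof (rule power2_le_imp_le)
  have "(norm (X ** Y))\<^sup>2 = (\<Sum>j\<in>UNIV. (norm (X *v column j Y))\<^sup>2)"
    by (simp add: power2_norm_eq_inner inner_columns column_matrix_mult)
  also have "\<dots> \<le> (\<Sum>j\<in>UNIV. (norm X * norm (column j Y))\<^sup>2)"
    by (intro sum_mono power_mono norm_matrix_vector_le) auto
  also have "\<dots> = (norm X * norm Y)\<^sup>2"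
    by (simp add: power_mult_distrib power2_norm_eq_inner inner_columns[of Y] sum_distrib_left)
  finally show "(norm (X ** Y))\<^sup>2 \<le> (norm X * norm Y)\<^sup>2" .
qed simp

lemma hpsd_iff: "hpsd A \<longleftrightarrow> ctranspose A = A \<and> (\<forall>x. 0 \<le> x \<bullet> (A *v x))"
  by (simp add: hpsd_def inner_vec_def inner_complex_def)

section \<open>Extremal vectors of Hermitian forms\<close>

text \<open>First-order condition at a minimiser of the Rayleigh quotient: moving \<open>y\<close>
  against the residual \<open>z = A y - m y\<close> would make the form of \<open>A - m\<close>
  negative. It serves with \<open>m = 0\<close> for kernels of semidefinite forms and with the
  smallest eigenvalue below.\<close>

lemma hermitian_min_eigenvector:
  fixes A :: "complex^'n^'n"
  assumes herm: "ctranspose A = A" and ge: "\<And>x. m * (x \<bullet> x) \<le> x \<bullet> (A *v x)"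
    and eq: "y \<bullet> (A *v y) = m * (y \<bullet> y)"
  shows "A *v y = m *\<^sub>R y"
proof (rule ccontr)
  define z where "z = A *v y - m *\<^sub>R y"
  define a where "a = z \<bullet> z"
  define b where "b = z \<bullet> (A *v z) - m * (z \<bullet> z)"
  assume "A *v y \<noteq> m *\<^sub>R y"
  then have a: "a > 0" by (simp add: a_def z_def)
  have b: "b \<ge> 0" using ge[of z] by (simp add: b_def)
  note sc = linear_cmul[OF linear_matrix_vector[of A]]
  have yz: "y \<bullet> (A *v z) = z \<bullet> (A *v y)"
    using inner_matrix_vector[of A z y] herm by (simp add: inner_commute)
  have a': "a = z \<bullet> (A *v y) - m * (z \<bullet> y)"
    by (simp add: a_def z_def inner_diff_right)
  have *: "0 \<le> 2 * t * a + t * t * b" for t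
  proof -
    have "0 \<le> (y + t *\<^sub>R z) \<bullet> (A *v (y + t *\<^sub>R z)) - m * ((y + t *\<^sub>R z) \<bullet> (y + t *\<^sub>R z))"
      using ge by simp
    also have "\<dots> = 2 * t * a + t * t * b"
      using eq yz unfolding a' b_def
      by (simp add: matrix_vector_right_distrib sc inner_add_left inner_add_right algebra_simps
          inner_commute[of y z])
    finally show ?thesis .
  qed
  \<comment> \<open>This \<open>t\<close> gives
    \<open>- (a\<^sup>2 / (b + 1)) * (2 - b / (b + 1))\<close>, which is negative; adding
    \<open>1\<close> to \<open>b\<close> keeps the denominator positive when
    \<open>b = 0\<close>.\<close>
  show False using *[of "- a / (b + 1)"] a b
    by (simp add: divide_simps split: if_splits)
qed

lemma hpsd_inner_nonneg: "hpsd \<Lambda> \<Longrightarrow> 0 \<le> X \<bullet> (X ** \<Lambda>)"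
  unfolding hpsd_iff by (auto simp: inner_form_columns intro!: sum_nonneg)

text \<open>A nonnegative sum vanishes only termwise, and a vector on which a semidefinite form
  vanishes minimises it, hence lies in the kernel. This is applied to every column of
  \<open>ctranspose X\<close>.\<close>

lemma hpsd_inner_eq_0:
  assumes L: "hpsd \<Lambda>" and 0: "X \<bullet> (X ** \<Lambda>) = 0"
  shows "X ** \<Lambda> = 0"
proof -
  have herm: "ctranspose \<Lambda> = \<Lambda>" and nn: "\<And>x. 0 \<le> x \<bullet> (\<Lambda> *v x)"
    using L by (auto simp: hpsd_iff)
  have z: "column j (ctranspose X) \<bullet> (\<Lambda> *v column j (ctranspose X)) = 0" for j
    using 0 unfolding inner_form_columns[OF herm] by (subst (asm) sum_nonneg_eq_0_iff) (auto simp: nn)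
  have "\<Lambda> *v column j (ctranspose X) = 0" for j
    using hermitian_min_eigenvector[OF herm, of 0 "column j (ctranspose X)"] nn z by simp
  then have "column j (ctranspose (X ** \<Lambda>)) = 0" for j
    by (simp add: ctranspose_mult herm column_matrix_mult)
  then show ?thesis by (simp add: column_def ctranspose_def vec_eq_iff)
qed

text \<open>The form attains its minimum on the compact unit sphere; homogeneity extends the bound
  to all vectors, and the minimiser is an eigenvector.\<close>

lemma hermitian_min_eigenvalue:
  fixes A :: "complex^'n^'n"
  assumes herm: "ctranspose A = A"
  obtains m y where "norm y = 1" "A *v y = m *\<^sub>R y" "\<And>x. m * (x \<bullet> x) \<le> x \<bullet> (A *v x)"
proof -
  let ?S = "sphere (0::complex^'n) 1"
  note lin = linear_matrix_vector[of A]
  have "continuous_on ?S (\<lambda>x. x \<bullet> (A *v x))"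
    by (intro continuous_intros linear_continuous_on linear_conv_bounded_linear[THEN iffD1] lin)
  moreover have "?S \<noteq> {}"
    by (metis dist_0_norm empty_iff mem_sphere vector_choose_size zero_le_one)
  ultimately obtain y where y: "y \<in> ?S" and min: "\<And>x. x \<in> ?S \<Longrightarrow> y \<bullet> (A *v y) \<le> x \<bullet> (A *v x)"
    using continuous_attains_inf[of ?S "\<lambda>x. x \<bullet> (A *v x)"] by auto
  define m where "m = y \<bullet> (A *v y)"
  have y1: "norm y = 1" using y by simp
  have ge: "m * (x \<bullet> x) \<le> x \<bullet> (A *v x)" for x
  proof (cases "x = 0")
    case False
    have "m \<le> (x /\<^sub>R norm x) \<bullet> (A *v (x /\<^sub>R norm x))"
      unfolding m_def using False by (intro min) simp
    also have "\<dots> = (x \<bullet> (A *v x)) / (x \<bullet> x)"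
      by (simp add: linear_cmul[OF lin] power2_norm_eq_inner[symmetric] power2_eq_square divide_simps)
    finally show ?thesis using False by (simp add: divide_simps)
  qed simp
  have "A *v y = m *\<^sub>R y"
    by (rule hermitian_min_eigenvector[OF herm ge]) (simp add: m_def y1 power2_norm_eq_inner[symmetric])
  from y1 this ge show thesis by (rule that)
qed

subsection \<open>Characteristic polynomial and singular values\<close>

lemma poly_char_polynomial: "poly (char_polynomial A) z = det (mat z - A)"
  unfolding char_polynomial_def det_def
  by (auto simp: poly_sum poly_prod mat_def intro!: sum.cong prod.cong)

lemma poly_char_polynomial_eq_0_iff:
  "poly (char_polynomial A) z = 0 \<longleftrightarrow> (\<exists>x. x \<noteq> 0 \<and> A *v x = z *s x)"
proof -
  have e: "(mat z - A) *v x = z *s x - A *v x" for x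
    by (simp add: matrix_vector_mult_diff_rdistrib)
       (simp add: vec_eq_iff matrix_vector_mult_def mat_def if_distrib[of "\<lambda>c. c * _"] cong: if_cong)
  have "poly (char_polynomial A) z = 0 \<longleftrightarrow> \<not> invertible (mat z - A)"
    by (simp add: poly_char_polynomial invertible_det_nz)
  also have "\<dots> \<longleftrightarrow> (\<exists>x. x \<noteq> 0 \<and> z *s x = A *v x)"
    unfolding invertible_left_inverse matrix_left_invertible_ker e right_minus_eq by blast
  finally show ?thesis by metis
qed

text \<open>Off-diagonal entries of the characteristic matrix are constants, so factors may have
  degree \<open>0\<close>. Hence the coefficient at \<open>card S\<close> is computed along with a
  mere upper bound on the degree.\<close>

lemma coeff_prod_degree_le_1:
  assumes "finite S" "\<And>i. i \<in> S \<Longrightarrow> degree (p i) \<le> 1"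
  shows "degree (prod p S) \<le> card S \<and> coeff (prod p S) (card S) = (\<Prod>i\<in>S. coeff (p i) 1)"
  using assms
proof (induction S rule: finite_induct)
  case (insert i S)
  then have IH: "degree (prod p S) \<le> card S" "coeff (prod p S) (card S) = (\<Prod>i\<in>S. coeff (p i) 1)"
    and d: "degree (p i) \<le> 1" by auto
  have "degree (prod p (insert i S)) \<le> Suc (card S)"
    using insert.hyps IH(1) d by (simp add: order.trans[OF degree_mult_le])
  moreover have "p i = [:coeff (p i) 0, coeff (p i) 1:]"
    by (rule poly_eqI) (use d in \<open>auto simp: coeff_pCons coeff_eq_0 split: nat.split\<close>)
  then obtain a b where ab: "p i = [:a, b:]" ..
  have "coeff (p i * prod p S) (Suc (card S)) = coeff (p i) 1 * coeff (prod p S) (card S)"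
    using IH(1) by (simp add: ab coeff_eq_0)
  ultimately show ?case using insert.hyps IH(2) by simp
qed simp

text \<open>The coefficient at \<open>CARD('n)\<close> only sees the linear coefficients of the
  entries, which form \<open>mat 1\<close>, so it equals \<open>det (mat 1) = 1\<close>. The
  polynomial is therefore nonzero, and its roots can be counted.\<close>

lemma degree_char_polynomial: "degree (char_polynomial A) = CARD('n)" for A :: "complex^'n^'n"
proof -
  define M where "M i j = (if i = j then [:0, 1:] else 0) - [:A $ i $ j:]" for i j
  have d: "degree (M i j) \<le> 1" and c: "coeff (M i j) 1 = mat 1 $ i $ j" for i j
    by (auto simp: M_def mat_def)
  have M: "degree (\<Prod>i\<in>UNIV. M i (p i)) \<le> CARD('n)"
    "coeff (\<Prod>i\<in>UNIV. M i (p i)) CARD('n) = (\<Prod>i\<in>UNIV. mat 1 $ i $ p i)" for p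
    using coeff_prod_degree_le_1[of UNIV "\<lambda>i. M i (p i)"] d c by auto
  have cp: "char_polynomial A = (\<Sum>p | p permutes UNIV. of_int (sign p) * (\<Prod>i\<in>UNIV. M i (p i)))"
    by (simp add: char_polynomial_def det_def M_def)
  have sg: "of_int (sign p) * q = smult (of_int (sign p)) q" for p :: "'n \<Rightarrow> 'n" and q :: "complex poly"
    by (simp add: sign_def)
  have "degree (char_polynomial A) \<le> CARD('n)"
    unfolding cp sg by (intro degree_sum_le order.trans[OF degree_smult_le] M) auto
  moreover have "coeff (char_polynomial A) CARD('n) = det (mat 1 :: complex^'n^'n)"
    unfolding cp sg coeff_sum det_def by (simp add: M)
  then have "CARD('n) \<le> degree (char_polynomial A)"
    by (intro le_degree) simp
  ultimately show ?thesis by simp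
qed

lemma set_proots_char_polynomial:
  "set_mset (proots (char_polynomial A)) = {z. \<exists>x. x \<noteq> 0 \<and> A *v x = z *s x}"
  for A :: "complex^'n^'n"
proof -
  have "char_polynomial A \<noteq> 0"
    using degree_char_polynomial[of A] by auto
  then show ?thesis by (simp add: poly_char_polynomial_eq_0_iff)
qed

lemma set_singular_values:
  fixes A :: "complex^'k^'n"
  assumes "CARD('k) \<le> CARD('n)"
  shows "set (singular_values A) = {sqrt (Re z) |z. \<exists>x. x \<noteq> 0 \<and> (ctranspose A ** A) *v x = z *s x}"
  using assms by (auto simp: singular_values_def set_proots_char_polynomial)

text \<open>By the fundamental theorem of algebra there are as many roots, with multiplicity, as the
  degree. This makes the minimum range over a nonempty set and keeps the indices
  \<open>pos a\<close> within the list.\<close>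

lemma length_singular_values:
  fixes A :: "complex^'k^'n"
  assumes "CARD('k) \<le> CARD('n)"
  shows "length (singular_values A) = CARD('k)"
  using assms by (simp add: singular_values_def size_mset[symmetric] size_proots_complex degree_char_polynomial
      del: size_mset)

lemma inner_complex_scale: "x \<bullet> (z *s x) = Re z * (x \<bullet> x)" for x :: "complex^'n"
  by (simp add: inner_vec_def inner_complex_def sum_distrib_left algebra_simps)

lemma of_real_scale: "of_real r *s x = r *\<^sub>R x" for x :: "complex^'n"
  unfolding vec_eq_iff vector_scaleR_component vector_smult_component
  by (simp add: scaleR_conv_of_real)

text \<open>For an eigenvector \<open>x\<close> of the Gram matrix with eigenvalue \<open>z\<close>,
  the squared norm of \<open>A x\<close> is \<open>Re z\<close> times that of \<open>x\<close>; it
  remains to normalise \<open>x\<close>.\<close>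

lemma singular_valuesE:
  fixes A :: "complex^'k^'n"
  assumes "CARD('k) \<le> CARD('n)" "s \<in> set (singular_values A)"
  obtains x where "norm x = 1" "s = norm (A *v x)"
proof -
  obtain z x where x: "x \<noteq> 0" "(ctranspose A ** A) *v x = z *s x" and s: "s = sqrt (Re z)"
    using assms set_singular_values[of A] by auto
  have "(norm (A *v x))\<^sup>2 = x \<bullet> ((ctranspose A ** A) *v x)"
    by (simp add: power2_norm_eq_inner inner_matrix_vector matrix_vector_mul_assoc)
  also have "\<dots> = Re z * (norm x)\<^sup>2"
    by (simp add: x inner_complex_scale power2_norm_eq_inner)
  finally have "Re z = (norm (A *v x) / norm x)\<^sup>2"
    using x(1) by (simp add: power_divide)
  then have "s = norm (A *v (x /\<^sub>R norm x))"
    by (simp add: s linear_cmul[OF linear_matrix_vector] divide_inverse mult.commute)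
  then show thesis using that[of "x /\<^sub>R norm x"] x(1) by simp
qed

lemma singular_values_nonneg:
  fixes A :: "complex^'k^'n"
  assumes "CARD('k) \<le> CARD('n)" "s \<in> set (singular_values A)"
  shows "0 \<le> s"
  using assms by (elim singular_valuesE) auto

lemma sigma_min_nonneg:
  fixes A :: "complex^'k^'n"
  assumes "CARD('k) \<le> CARD('n)"
  shows "0 \<le> sigma_min A"
proof -
  have "set (singular_values A) \<noteq> {}"
    using length_singular_values[OF assms, of A] by auto
  then show ?thesis
    unfolding sigma_min_def using singular_values_nonneg[OF assms] by (subst Min_ge_iff) auto
qed

text \<open>The Gram matrix of \<open>P ** \<Lambda>\<close> is
  \<open>\<Lambda> ** \<Lambda>\<close>, so the smallest eigenvalue \<open>m\<close> of
  \<open>\<Lambda>\<close> is a singular value of \<open>P ** \<Lambda>\<close>. Thus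
  \<open>sigma_min\<close> is at most \<open>m\<close>, which bounds the form from below.\<close>

lemma sigma_min_norm_le_inner:
  fixes P :: "complex^'k^'n" and X :: "complex^'k^'m"
  assumes "CARD('k) \<le> CARD('n)" and P: "P \<in> stiefel" and L: "hpsd \<Lambda>"
  shows "sigma_min (P ** \<Lambda>) * (norm X)\<^sup>2 \<le> X \<bullet> (X ** \<Lambda>)"
proof -
  have herm: "ctranspose \<Lambda> = \<Lambda>" using L by (simp add: hpsd_def)
  obtain m y where y: "norm y = 1" "\<Lambda> *v y = m *\<^sub>R y" and ge: "\<And>x. m * (x \<bullet> x) \<le> x \<bullet> (\<Lambda> *v x)"
    using hermitian_min_eigenvalue[OF herm] by blast
  have m: "0 \<le> m"
    using L y by (auto simp: hpsd_iff norm_eq_1 dest: spec[of _ y])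
  have "ctranspose (P ** \<Lambda>) ** (P ** \<Lambda>) = \<Lambda> ** (ctranspose P ** P) ** \<Lambda>"
    by (simp add: ctranspose_mult herm matrix_mul_assoc)
  also have "\<dots> = \<Lambda> ** \<Lambda>"
    using P by (simp add: stiefel_def)
  finally have "(ctranspose (P ** \<Lambda>) ** (P ** \<Lambda>)) *v y = of_real (m\<^sup>2) *s y"
    using y(2) by (simp add: matrix_vector_mul_assoc[symmetric] linear_cmul[OF linear_matrix_vector]
        of_real_scale power2_eq_square del: of_real_power of_real_mult)
  moreover have "y \<noteq> 0" using y(1) by auto
  ultimately have "sqrt (Re (of_real (m\<^sup>2))) \<in> set (singular_values (P ** \<Lambda>))"
    unfolding set_singular_values[OF assms(1)] by blast
  then have "m \<in> set (singular_values (P ** \<Lambda>))"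
    using m by (simp del: of_real_power)
  then have le: "sigma_min (P ** \<Lambda>) \<le> m"
    unfolding sigma_min_def by (intro Min_le) auto
  have "sigma_min (P ** \<Lambda>) * (norm X)\<^sup>2 \<le> m * (norm (ctranspose X))\<^sup>2"
    using le by (simp add: norm_ct mult_right_mono)
  also have "\<dots> = (\<Sum>j\<in>UNIV. m * (column j (ctranspose X) \<bullet> column j (ctranspose X)))"
    by (simp add: power2_norm_eq_inner inner_columns sum_distrib_left)
  also have "\<dots> \<le> X \<bullet> (X ** \<Lambda>)"
    unfolding inner_form_columns[OF herm] by (intro sum_mono ge)
  finally show ?thesis .
qed

subsection \<open>Polar factors and canonical angles\<close>

lemma stiefelD: "P \<in> stiefel \<Longrightarrow> ctranspose P ** P = mat 1"
  by (simp add: stiefel_def)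

lemma norm_stiefel_mult: "P \<in> stiefel \<Longrightarrow> norm (P ** X) = norm X"
  by (simp add: norm_eq inner_mult_left matrix_mul_assoc stiefelD)

lemma norm_stiefel_vector: "P \<in> stiefel \<Longrightarrow> norm (P *v x) = norm x"
  by (simp add: norm_eq inner_matrix_vector matrix_vector_mul_assoc stiefelD)

lemma norm_stiefel:
  assumes "P \<in> stiefel"
  shows "norm (P :: complex^'k^'n) = norm (mat 1 :: complex^'k^'k)"
  using norm_stiefel_mult[OF assms, of "mat 1"] by simp

text \<open>Pythagoras for the orthogonal projector \<open>P ** ctranspose P\<close>.\<close>

lemma norm_stiefel_residual_vector:
  assumes "P \<in> stiefel"
  shows "(norm (w - P *v (ctranspose P *v w)))\<^sup>2 = (norm w)\<^sup>2 - (norm (ctranspose P *v w))\<^sup>2"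
proof -
  let ?p = "ctranspose P *v w"
  have "w \<bullet> (P *v ?p) = ?p \<bullet> ?p"
    by (simp add: inner_matrix_vector)
  moreover have "(P *v ?p) \<bullet> (P *v ?p) = ?p \<bullet> ?p"
    using norm_stiefel_vector[OF assms, of ?p] by (simp add: norm_eq)
  ultimately show ?thesis
    by (simp add: power2_norm_eq_inner inner_diff_left inner_diff_right inner_commute[of "P *v ?p" w])
qed

lemma norm_stiefel_residual_le:
  assumes "P \<in> stiefel"
  shows "norm (X - P ** (ctranspose P ** X)) \<le> norm X"
proof (rule power2_le_imp_le)
  let ?p = "ctranspose P ** X"
  have "X \<bullet> (P ** ?p) = ?p \<bullet> ?p"
    by (simp add: inner_mult_left)
  moreover have "(P ** ?p) \<bullet> (P ** ?p) = ?p \<bullet> ?p"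
    using norm_stiefel_mult[OF assms, of ?p] by (simp add: norm_eq)
  ultimately have "(norm (X - P ** ?p))\<^sup>2 = (norm X)\<^sup>2 - (norm ?p)\<^sup>2"
    by (simp add: power2_norm_eq_inner inner_diff_left inner_diff_right inner_commute[of "P ** ?p" X])
  then show "(norm (X - P ** ?p))\<^sup>2 \<le> (norm X)\<^sup>2" by simp
qed simp

text \<open>Both diagonal terms of the expanded form equal the real trace of
  \<open>\<Lambda>\<close>, because \<open>P\<close> and \<open>Q\<close> have orthonormal columns;
  the two cross terms agree because \<open>\<Lambda>\<close> is Hermitian.\<close>

lemma polar_gap:
  assumes P: "P \<in> stiefel" and Q: "Q \<in> stiefel" and L: "ctranspose \<Lambda> = \<Lambda>"
  shows "(P - Q) \<bullet> ((P - Q) ** \<Lambda>) = 2 * ((P ** \<Lambda>) \<bullet> P - (P ** \<Lambda>) \<bullet> Q)"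
proof -
  have *: "(R ** \<Lambda>) \<bullet> R = \<Lambda> \<bullet> mat 1" if "R \<in> stiefel" for R :: "complex^'a^'b"
    using inner_mult_left[of R \<Lambda> R] by (simp add: stiefelD that)
  have "P \<bullet> (Q ** \<Lambda>) = (P ** \<Lambda>) \<bullet> Q"
    by (simp add: inner_mult_right L)
  then show ?thesis
    by (simp add: matrix_diff_rdistrib inner_diff_left inner_diff_right *[OF P] *[OF Q]
        inner_commute[of P "P ** \<Lambda>"] inner_commute[of Q "P ** \<Lambda>"] inner_commute[of Q "Q ** \<Lambda>"])
qed

text \<open>By \<open>polar_gap\<close> the difference is half a semidefinite form at
  \<open>P - Q\<close>: a polar factor maximises the linearised objective over the Stiefel
  manifold.\<close>

lemma polar_factor_inner_le:
  assumes "polar_factor H P" "Q \<in> stiefel"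
  shows "H \<bullet> Q \<le> H \<bullet> P"
proof -
  obtain \<Lambda> where "P \<in> stiefel" "hpsd \<Lambda>" "H = P ** \<Lambda>"
    using assms by (auto simp: polar_factor_def)
  then show ?thesis
    using hpsd_inner_nonneg[of \<Lambda> "P - Q"] polar_gap[of P Q \<Lambda>] assms(2)
    by (simp add: hpsd_def)
qed

lemma polar_factor_gap_sigma_min:
  fixes P Q :: "complex^'k^'n"
  assumes "CARD('k) \<le> CARD('n)" "polar_factor H P" "Q \<in> stiefel"
  shows "sigma_min H * (norm (P - Q))\<^sup>2 \<le> 2 * (H \<bullet> P - H \<bullet> Q)"
proof -
  obtain \<Lambda> where "P \<in> stiefel" "hpsd \<Lambda>" "H = P ** \<Lambda>"
    using assms by (auto simp: polar_factor_def)
  then show ?thesis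
    using sigma_min_norm_le_inner[OF assms(1), of P \<Lambda> "P - Q"] polar_gap[of P Q \<Lambda>] assms(3)
    by (simp add: hpsd_def)
qed

text \<open>In the equality case the form at \<open>P - Q\<close> vanishes, so
  \<open>(P - Q) ** \<Lambda> = 0\<close> and \<open>H = Q ** \<Lambda>\<close> with the same
  \<open>\<Lambda>\<close>. The second conclusion is kept for the uniqueness argument.\<close>

lemma polar_factor_inner_eq:
  assumes "polar_factor H P" "Q \<in> stiefel" "H \<bullet> Q = H \<bullet> P"
  shows "polar_equation H Q" "(P - Q) ** (ctranspose Q ** H) = 0"
proof -
  obtain \<Lambda> where P: "P \<in> stiefel" and L: "hpsd \<Lambda>" and H: "H = P ** \<Lambda>"
    using assms by (auto simp: polar_factor_def)
  have "(P - Q) \<bullet> ((P - Q) ** \<Lambda>) = 0"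
    using polar_gap[OF P assms(2)] L assms(3) H by (simp add: hpsd_def)
  then have 0: "(P - Q) ** \<Lambda> = 0"
    by (rule hpsd_inner_eq_0[OF L])
  then have HQ: "H = Q ** \<Lambda>"
    by (simp add: H matrix_diff_rdistrib)
  then have "ctranspose Q ** H = \<Lambda>"
    using stiefelD[OF assms(2)] by (simp add: matrix_mul_assoc)
  then show "polar_equation H Q" "(P - Q) ** (ctranspose Q ** H) = 0"
    using L 0 HQ by (simp_all add: polar_equation_def)
qed

lemma full_rank_left_inverse:
  fixes H :: "complex^'k^'n"
  assumes "rank H = CARD('k)"
  obtains C where "C ** H = mat 1"
proof -
  have "vec.span (rows H) = UNIV"
    using assms unfolding row_rank_def_gen by (intro vec.dim_eq_full[THEN iffD1]) (simp add: vec.dimension_def card_cart_basis)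
  then show thesis using that matrix_left_invertible_span_rows_gen by blast
qed

lemma polar_factor_full_rank_unique:
  fixes P Q :: "complex^'k^'n"
  assumes H: "polar_factor H P" and Q: "Q \<in> stiefel" "H \<bullet> Q = H \<bullet> P" and r: "rank H = CARD('k)"
  shows "P = Q"
proof -
  let ?L = "ctranspose Q ** H"
  obtain C where "C ** H = mat 1" using full_rank_left_inverse[OF r] .
  moreover have "H = Q ** ?L"
    using polar_factor_inner_eq(1)[OF H Q] by (simp add: polar_equation_def)
  ultimately have "C ** (Q ** ?L) = mat 1" by simp
  then have "(C ** Q) ** ?L = mat 1"
    unfolding matrix_mul_assoc[of C Q ?L] .
  \<comment> \<open>\<open>ctranspose Q ** H\<close> is square, so its left inverse is also a right
    inverse, and it can be cancelled in \<open>(P - Q) ** (ctranspose Q ** H) = 0\<close>.\<close>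
  then have inv: "?L ** (C ** Q) = mat 1"
    using matrix_left_right_inverse by blast
  have "P - Q = (P - Q) ** (?L ** (C ** Q))"
    by (simp only: inv matrix_mul_rid)
  also have "\<dots> = ((P - Q) ** ?L) ** (C ** Q)"
    by (rule matrix_mul_assoc)
  also have "\<dots> = 0"
    unfolding polar_factor_inner_eq(2)[OF H Q] by simp
  finally show ?thesis by simp
qed

text \<open>The projector onto the complement of the range of \<open>Q\<close> kills
  \<open>Q\<close>, so the residual is the projection of \<open>P - Q\<close> times
  \<open>\<Lambda>\<close>; moreover \<open>norm \<Lambda> = norm H\<close> since \<open>P\<close>
  is an isometry. For \<open>H = 0\<close> the quotient is \<open>0\<close>.\<close>

lemma polar_factor_residual_le:
  assumes H: "polar_factor H P" and Q: "Q \<in> stiefel"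
  shows "(norm (H - Q ** (ctranspose Q ** H)))\<^sup>2 / (norm H)\<^sup>2 \<le> (norm (P - Q))\<^sup>2"
proof -
  obtain \<Lambda> where P: "P \<in> stiefel" and HL: "H = P ** \<Lambda>"
    using H by (auto simp: polar_factor_def)
  let ?D = "P - Q"
  have QQ: "Q ** (ctranspose Q ** Q) = Q" by (simp add: stiefelD[OF Q])
  have "H - Q ** (ctranspose Q ** H) = (?D - Q ** (ctranspose Q ** ?D)) ** \<Lambda>"
    using QQ by (simp add: HL matrix_diff_rdistrib matrix_diff_ldistrib matrix_mul_assoc)
  then have "norm (H - Q ** (ctranspose Q ** H)) \<le> norm (?D - Q ** (ctranspose Q ** ?D)) * norm \<Lambda>"
    by (simp only: norm_matrix_mult_le)
  also have "\<dots> \<le> norm ?D * norm H"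
    by (simp add: HL norm_stiefel_mult[OF P] mult_right_mono norm_stiefel_residual_le[OF Q])
  finally have "(norm (H - Q ** (ctranspose Q ** H)))\<^sup>2 \<le> (norm ?D * norm H)\<^sup>2"
    by (rule power_mono) simp
  then show ?thesis
    by (cases "H = 0") (simp_all add: divide_le_eq power_mult_distrib)
qed

section \<open>Column spaces and sines of canonical angles\<close>

lemma col_space_eq_range: "col_space A = range ((*v) A)"
proof
  have "column j A = A *v axis j 1" for j
    by (simp add: vec_eq_iff column_def matrix_vector_mult_def axis_def if_distrib[of "\<lambda>c. _ * c"] cong: if_cong)
  then have "columns A \<subseteq> range ((*v) A)"
    by (auto simp: columns_def)
  moreover have "vec.subspace (range ((*v) A))"
    by (rule vec.linear_subspace_image[OF matrix_vector_mul_linear_gen vec.subspace_UNIV])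
  ultimately show "col_space A \<subseteq> range ((*v) A)"
    unfolding col_space_def by (rule vec.span_minimal)
  show "range ((*v) A) \<subseteq> col_space A"
    unfolding col_space_def by (auto intro: matrix_vector_mult_in_columnspace_gen)
qed

text \<open>The basis picked by \<open>SOME\<close> differs from \<open>P\<close> only by a unitary
  factor \<open>W\<close> and gives the same orthogonal projector. Estimates can therefore be made
  with \<open>P\<close> itself.\<close>

lemma orthonormal_basis_matrix:
  fixes P :: "complex^'k^'n"
  assumes P: "P \<in> stiefel"
  defines "R \<equiv> orthonormal_basis_matrix (col_space P) :: complex^'k^'n"
  obtains W where "R \<in> stiefel" "R = P ** W" "W \<in> stiefel" "R ** ctranspose R = P ** ctranspose P"
proof -
  have R: "R \<in> stiefel" "col_space R = col_space P"
    using someI[of "\<lambda>R::complex^'k^'n. R \<in> stiefel \<and> col_space R = col_space P" P] P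
    by (auto simp: R_def orthonormal_basis_matrix_def)
  have "\<exists>w. column j R = P *v w" for j
  proof -
    have "column j R \<in> col_space R"
      unfolding col_space_def by (rule vec.span_base) (auto simp: columns_def)
    then have "column j R \<in> range ((*v) P)"
      unfolding R(2) unfolding col_space_eq_range .
    then show ?thesis by auto
  qed
  then obtain w where w: "\<And>j. column j R = P *v w j" by metis
  define W where "W = (\<chi> i j. w j $ i)"
  have RW: "R = P ** W"
    using w by (auto simp: vec_eq_iff column_def W_def matrix_vector_mult_def matrix_matrix_mult_def)
  have "ctranspose W ** W = ctranspose W ** (ctranspose P ** P) ** W"
    by (simp add: stiefelD[OF P])
  also have "\<dots> = ctranspose R ** R"
    by (simp add: RW ctranspose_mult matrix_mul_assoc)
  finally have W: "W \<in> stiefel" by (simp add: stiefel_def stiefelD[OF R(1)])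
  then have WW: "W ** ctranspose W = mat 1"
    using matrix_left_right_inverse stiefelD by blast
  have "R ** ctranspose R = P ** (W ** ctranspose W) ** ctranspose P"
    by (simp add: RW ctranspose_mult matrix_mul_assoc)
  then have "R ** ctranspose R = P ** ctranspose P" by (simp add: WW)
  with R(1) RW W show thesis by (rule that)
qed

text \<open>The cosine \<open>c\<close> is the length of the projection onto the range of
  \<open>P\<close> of a unit vector \<open>z = Q y\<close>. So \<open>1 - c\<^sup>2\<close> is the
  squared distance of \<open>z\<close> from that range, and \<open>P y\<close> is a point of the
  range at distance at most \<open>norm (P - Q)\<close>.\<close>

lemma sin_canonical_angle:
  fixes P Q :: "complex^'k::{finite,linorder}^'n" and a :: "'k::{finite,linorder}"
  assumes P: "P \<in> stiefel" and Q: "Q \<in> stiefel"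
  defines "\<Theta> \<equiv> canonical_angles (col_space P) (col_space Q) :: real^'k::{finite,linorder}^'k::{finite,linorder}"
  shows "(sin (\<Theta> $ a $ a))\<^sup>2 \<le> (norm (P - Q))\<^sup>2"
proof -
  define P0 where "P0 = (orthonormal_basis_matrix (col_space P) :: complex^'k::{finite,linorder}^'n)"
  define Q0 where "Q0 = (orthonormal_basis_matrix (col_space Q) :: complex^'k::{finite,linorder}^'n)"
  have P0: "P0 \<in> stiefel" "P0 ** ctranspose P0 = P ** ctranspose P"
    unfolding P0_def by (rule orthonormal_basis_matrix[OF P]; assumption)+
  obtain W where Q0: "Q0 \<in> stiefel" "Q0 = Q ** W" and W: "W \<in> stiefel"
    unfolding Q0_def by (rule orthonormal_basis_matrix[OF Q])
  define c where "c = singular_values (ctranspose P0 ** Q0) ! pos a"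
  have "pos a < CARD('k)"
    unfolding pos_def by (intro psubset_card_mono) auto
  then have "c \<in> set (singular_values (ctranspose P0 ** Q0))"
    unfolding c_def by (intro nth_mem) (simp add: length_singular_values)
  then obtain x where x: "norm x = 1" and c: "c = norm ((ctranspose P0 ** Q0) *v x)"
    by (rule singular_valuesE[OF order_refl])
  let ?z = "Q0 *v x" and ?y = "W *v x"
  let ?d = "(Q - P) *v ?y"
  have c2: "c\<^sup>2 = (norm (ctranspose P0 *v ?z))\<^sup>2"
    by (simp add: c matrix_vector_mul_assoc)
  have "1 - c\<^sup>2 = (norm (?z - P0 *v (ctranspose P0 *v ?z)))\<^sup>2"
    unfolding norm_stiefel_residual_vector[OF P0(1)] c2 by (simp add: norm_stiefel_vector[OF Q0(1)] x)
  also have "P0 *v (ctranspose P0 *v ?z) = P *v (ctranspose P *v ?z)"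
    by (simp add: matrix_vector_mul_assoc matrix_mul_assoc P0(2))
  \<comment> \<open>Subtracting the vector \<open>P y\<close> of the range of \<open>P\<close>
    leaves the projection residual unchanged.\<close>
  also have "?z - P *v (ctranspose P *v ?z) = ?d - P *v (ctranspose P *v ?d)"
  proof -
    have z: "?z = Q *v ?y" by (simp add: Q0(2) matrix_vector_mul_assoc)
    have "ctranspose P *v (P *v y) = y" for y
      by (simp add: matrix_vector_mul_assoc stiefelD[OF P])
    then show ?thesis unfolding z
      by (simp add: matrix_vector_mult_diff_rdistrib matrix_vector_mult_diff_distrib)
  qed
  also have "(norm \<dots>)\<^sup>2 \<le> (norm ?d)\<^sup>2"
    unfolding norm_stiefel_residual_vector[OF P] by simp
  also have "\<dots> \<le> (norm (P - Q))\<^sup>2"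
    using norm_matrix_vector_le[of "Q - P" ?y]
    by (intro power_mono) (simp_all add: norm_stiefel_vector[OF W] x norm_minus_commute)
  finally have le: "1 - c\<^sup>2 \<le> (norm (P - Q))\<^sup>2" .
  \<comment> \<open>The bound on \<open>c\<close> ensures that
    \<open>cos (arccos c) = c\<close>.\<close>
  have "0 \<le> 1 - c\<^sup>2"
    unfolding \<open>1 - c\<^sup>2 = (norm (?z - P0 *v (ctranspose P0 *v ?z)))\<^sup>2\<close> by simp
  then have "\<bar>c\<bar> \<le> 1" by (simp add: abs_square_le_1)
  then have "(sin (arccos c))\<^sup>2 = 1 - c\<^sup>2"
    by (simp add: sin_squared_eq cos_arccos_abs)
  moreover have "\<Theta> $ a $ a = arccos c"
    by (simp add: \<Theta>_def canonical_angles_def Let_def c_def P0_def Q0_def)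
  ultimately show ?thesis using le by simp
qed

text \<open>Each of the \<open>CARD('k)\<close> sines is bounded separately; the constant does no
  harm to summability.\<close>

lemma norm_sin_canonical_angles_le:
  fixes P Q :: "complex^'k::{finite,linorder}^'n"
  assumes "P \<in> stiefel" "Q \<in> stiefel"
  shows "(norm (sin_diag (canonical_angles (col_space P) (col_space Q) :: real^'k::{finite,linorder}^'k::{finite,linorder})))\<^sup>2
    \<le> CARD('k) * (norm (P - Q))\<^sup>2"
proof -
  let ?T = "canonical_angles (col_space P) (col_space Q) :: real^'k::{finite,linorder}^'k::{finite,linorder}"
  have "(norm (sin_diag ?T))\<^sup>2 = (\<Sum>a\<in>UNIV. \<Sum>b\<in>UNIV. (sin_diag ?T $ a $ b)\<^sup>2)"
    by (simp add: power2_norm_eq_inner inner_vec_def power2_eq_square[of "_ $ _ $ _"])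
  also have "\<dots> = (\<Sum>a\<in>UNIV. \<Sum>b\<in>UNIV. if a = b then (sin (?T $ a $ a))\<^sup>2 else 0)"
    by (intro sum.cong) (simp_all add: sin_diag_def)
  also have "\<dots> = (\<Sum>a\<in>UNIV. (sin (?T $ a $ a))\<^sup>2)"
    by simp
  also have "\<dots> \<le> (\<Sum>a\<in>(UNIV::'k::{finite,linorder} set). (norm (P - Q))\<^sup>2)"
    by (intro sum_mono sin_canonical_angle assms)
  finally show ?thesis by simp
qed

subsection \<open>Limits and the objective\<close>

lemma tendsto_matrix_mult [tendsto_intros]:
  fixes A :: "complex^'b^'a" and C :: "complex^'c^'b"
  assumes "(f \<longlongrightarrow> A) F" "(g \<longlongrightarrow> C) F"
  shows "((\<lambda>x. f x ** g x) \<longlongrightarrow> A ** C) F"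
  unfolding matrix_matrix_mult_def by (intro tendsto_vec_lambda tendsto_intros assms)

lemma tendsto_ctranspose [tendsto_intros]:
  "(f \<longlongrightarrow> A) F \<Longrightarrow> ((\<lambda>x. ctranspose (f x)) \<longlongrightarrow> ctranspose A) F"
  unfolding ctranspose_def by (intro tendsto_vec_lambda tendsto_intros)

lemma tendsto_matrix_vector [tendsto_intros]:
  fixes A :: "complex^'b^'a"
  shows "(f \<longlongrightarrow> A) F \<Longrightarrow> ((\<lambda>x. f x *v y) \<longlongrightarrow> A *v y) F"
  unfolding matrix_vector_mult_def by (intro tendsto_vec_lambda tendsto_intros)

lemma tendsto_col_block [tendsto_intros]:
  assumes "(f \<longlongrightarrow> A) F"
  shows "((\<lambda>x. col_block \<tau> i (f x)) \<longlongrightarrow> col_block \<tau> i A) F"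
  unfolding col_block_def
  by (intro tendsto_vec_lambda) (use assms in \<open>auto intro!: tendsto_vec_nth\<close>)

lemma tendsto_grad_U [tendsto_intros]:
  "(f \<longlongrightarrow> X) F \<Longrightarrow> (g \<longlongrightarrow> Y) F \<Longrightarrow>
     ((\<lambda>x. grad_U \<tau> N B (f x) (g x)) \<longlongrightarrow> grad_U \<tau> N B X Y) F"
  unfolding grad_U_def by (intro tendsto_intros)

lemma grad_V_eq_grad_U: "grad_V \<tau> N B X Y = grad_U \<tau> N (\<lambda>l. ctranspose (B l)) Y X"
  by (simp add: grad_U_def grad_V_def)

lemma tendsto_grad_V [tendsto_intros]:
  "(f \<longlongrightarrow> X) F \<Longrightarrow> (g \<longlongrightarrow> Y) F \<Longrightarrow>
     ((\<lambda>x. grad_V \<tau> N B (f x) (g x)) \<longlongrightarrow> grad_V \<tau> N B X Y) F"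
  unfolding grad_V_eq_grad_U by (intro tendsto_intros)

section \<open>Compactness and limits of polar factors\<close>

lemma closed_stiefel: "closed (stiefel :: (complex^'k^'n) set)"
  unfolding closed_sequential_limits
proof (intro allI impI, elim conjE)
  fix X :: "nat \<Rightarrow> complex^'k^'n" and P
  assume X: "\<forall>n. X n \<in> stiefel" and "X \<longlonglongrightarrow> P"
  then have "(\<lambda>n. ctranspose (X n) ** X n) \<longlonglongrightarrow> ctranspose P ** P"
    by (intro tendsto_intros)
  moreover have "(\<lambda>n. ctranspose (X n) ** X n) = (\<lambda>n. mat 1)"
    using X by (simp add: stiefelD)
  ultimately show "P \<in> stiefel"
    by (simp add: stiefel_def LIMSEQ_const_iff)
qed

lemma compact_stiefel: "compact (stiefel :: (complex^'k^'n) set)"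
proof -
  have "bounded (stiefel :: (complex^'k^'n) set)"
    by (rule boundedI[of _ "norm (mat 1 :: complex^'k^'k)"]) (simp add: norm_stiefel)
  then show ?thesis using closed_stiefel by (simp add: compact_eq_bounded_closed)
qed

lemma hpsd_limit:
  assumes "\<And>n. hpsd (A n)" "A \<longlonglongrightarrow> L"
  shows "hpsd L"
  unfolding hpsd_iff
proof (intro conjI allI)
  have "(\<lambda>n. ctranspose (A n)) \<longlonglongrightarrow> ctranspose L"
    by (intro tendsto_intros assms)
  then have "A \<longlonglongrightarrow> ctranspose L"
    using assms(1) by (simp add: hpsd_def)
  then show "ctranspose L = L"
    using assms(2) by (rule LIMSEQ_unique)
  fix x
  have "(\<lambda>n. x \<bullet> (A n *v x)) \<longlonglongrightarrow> x \<bullet> (L *v x)"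
    by (intro tendsto_intros assms)
  then show "0 \<le> x \<bullet> (L *v x)"
    using assms(1) by (intro LIMSEQ_le_const) (auto simp: hpsd_iff)
qed

text \<open>The semidefinite factor is forced to be \<open>ctranspose P ** H\<close>. This removes
  the existential quantifier, so that limits can be taken directly.\<close>

lemma polar_factor_iff: "polar_factor H P \<longleftrightarrow> P \<in> stiefel \<and> polar_equation H P"
proof
  assume "polar_factor H P"
  then obtain \<Lambda> where P: "P \<in> stiefel" and L: "hpsd \<Lambda>" "H = P ** \<Lambda>"
    by (auto simp: polar_factor_def)
  then have "ctranspose P ** H = \<Lambda>"
    by (simp add: matrix_mul_assoc stiefelD)
  then show "P \<in> stiefel \<and> polar_equation H P"
    using P L by (simp add: polar_equation_def)
next
  assume "P \<in> stiefel \<and> polar_equation H P"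
  then show "polar_factor H P"
    unfolding polar_factor_def polar_equation_def by blast
qed

lemma polar_factor_limit:
  assumes pf: "\<And>n. polar_factor (H n) (P n)" and H: "H \<longlonglongrightarrow> h" and P: "P \<longlonglongrightarrow> p"
  shows "polar_factor h p"
proof -
  have st: "p \<in> stiefel"
    using closed_sequentially[OF closed_stiefel _ P] pf by (simp add: polar_factor_iff)
  have lim: "(\<lambda>n. ctranspose (P n) ** H n) \<longlonglongrightarrow> ctranspose p ** h"
    by (intro tendsto_intros H P)
  then have "hpsd (ctranspose p ** h)"
    using pf by (intro hpsd_limit[OF _ lim]) (simp add: polar_factor_iff polar_equation_def)
  moreover have "h = p ** (ctranspose p ** h)"
  proof (rule LIMSEQ_unique[OF H])
    have "P n ** (ctranspose (P n) ** H n) = H n" for n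
      using pf[of n] unfolding polar_factor_iff polar_equation_def by (elim conjE) (rule sym)
    moreover have "(\<lambda>n. P n ** (ctranspose (P n) ** H n)) \<longlonglongrightarrow> p ** (ctranspose p ** h)"
      by (intro tendsto_intros H P)
    ultimately show "H \<longlonglongrightarrow> p ** (ctranspose p ** h)" by simp
  qed
  ultimately show ?thesis
    using st unfolding polar_factor_iff polar_equation_def by blast
qed

text \<open>When the gap tends to zero, the limits satisfy the hypotheses of
  \<open>polar_factor_inner_eq\<close> and \<open>polar_factor_full_rank_unique\<close>.\<close>

lemma polar_factor_limit_inner_eq:
  assumes "\<And>n. polar_factor (H n) (P n)" "\<And>n. Q n \<in> stiefel"
    and "H \<longlonglongrightarrow> h" "P \<longlonglongrightarrow> p" "Q \<longlonglongrightarrow> q"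
    and gap: "(\<lambda>n. H n \<bullet> P n - H n \<bullet> Q n) \<longlonglongrightarrow> 0"
  shows "polar_factor h p" "q \<in> stiefel" "h \<bullet> q = h \<bullet> p"
proof -
  show "polar_factor h p" by (rule polar_factor_limit[OF assms(1,3,4)])
  show "q \<in> stiefel" by (rule closed_sequentially[OF closed_stiefel assms(2,5)])
  have "(\<lambda>n. H n \<bullet> P n - H n \<bullet> Q n) \<longlonglongrightarrow> h \<bullet> p - h \<bullet> q"
    by (intro tendsto_intros assms)
  from LIMSEQ_unique[OF gap this] show "h \<bullet> q = h \<bullet> p" by simp
qed

text \<open>For fixed \<open>Y\<close> the objective is a sum of squared norms of the linear maps
  \<open>T l\<close>. It is thus convex and exceeds its tangent by the sum of the terms
  \<open>T l h \<bullet> T l h\<close>.\<close>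

lemma objective_ge_tangent_U:
  "objective \<tau> N B X Y + (grad_U \<tau> N B X Y \<bullet> X' - grad_U \<tau> N B X Y \<bullet> X) \<le> objective \<tau> N B X' Y"
proof -
  define T where "T l Z = bdiag \<tau> (ctranspose Z ** (B l ** Y))" for l Z
  have lin: "linear (T l)" for l
    unfolding T_def by (rule linear_bd)
  have obj: "objective \<tau> N B Z Y = (\<Sum>l=1..N. T l Z \<bullet> T l Z)" for Z
    by (simp add: objective_def T_def power2_norm_eq_inner matrix_mul_assoc)
  define h where "h = X' - X"
  have *: "2 * (T l X \<bullet> T l h) = h \<bullet> (2 *\<^sub>R (\<Sum>i<length \<tau>. B l ** col_block \<tau> i Y **
      ctranspose (col_block \<tau> i Y) ** ctranspose (B l) ** col_block \<tau> i X))" for l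
    unfolding T_def col_block_inner_eq
    by (simp add: col_block_mult[symmetric] ctranspose_mult matrix_mul_assoc)
  have grad: "grad_U \<tau> N B X Y \<bullet> h = (\<Sum>l=1..N. 2 * (T l X \<bullet> T l h))"
    unfolding * inner_commute[of _ h] by (simp only: grad_U_def inner_sum_right scaleR_sum_right)
  have "T l X \<bullet> T l X + 2 * (T l X \<bullet> T l h) \<le> T l X' \<bullet> T l X'" for l
  proof -
    have "T l X' = T l X + T l h"
      unfolding h_def by (simp add: linear_diff[OF lin])
    then have "T l X' \<bullet> T l X' = T l X \<bullet> T l X + 2 * (T l X \<bullet> T l h) + T l h \<bullet> T l h"
      by (simp add: inner_add_left inner_add_right inner_commute[of "T l h" "T l X"])
    then show ?thesis by simp
  qed
  then have "(\<Sum>l=1..N. T l X \<bullet> T l X + 2 * (T l X \<bullet> T l h)) \<le> objective \<tau> N B X' Y"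
    unfolding obj by (rule sum_mono)
  moreover have "objective \<tau> N B X Y + grad_U \<tau> N B X Y \<bullet> h
      = (\<Sum>l=1..N. T l X \<bullet> T l X + 2 * (T l X \<bullet> T l h))"
    by (simp only: obj grad sum.distrib)
  ultimately show ?thesis
    by (simp add: inner_diff_right h_def)
qed

lemma objective_ge_tangent_V:
  "objective \<tau> N B X Y + (grad_V \<tau> N B X Y \<bullet> Y' - grad_V \<tau> N B X Y \<bullet> Y) \<le> objective \<tau> N B X Y'"
  unfolding objective_swap[of \<tau> N B X] grad_V_eq_grad_U by (rule objective_ge_tangent_U)

text \<open>By \<open>inner_bdiag\<close>, taking the block diagonal is an orthogonal projection;
  Cauchy-Schwarz then shows that it is a contraction.\<close>

lemma norm_bdiag_le: "norm (bdiag \<tau> A) \<le> norm A"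
proof -
  have "norm (bdiag \<tau> A) * norm (bdiag \<tau> A) \<le> norm (bdiag \<tau> A) * norm A"
    using norm_cauchy_schwarz[of "bdiag \<tau> A" A] inner_bdiag[of \<tau> A A]
    by (simp add: power2_norm_eq_inner[symmetric] power2_eq_square)
  then show ?thesis
    by (cases "bdiag \<tau> A = 0") auto
qed

lemma objective_bounded:
  obtains M where "\<And>X Y. X \<in> stiefel \<Longrightarrow> Y \<in> stiefel \<Longrightarrow>
    objective \<tau> N B (X :: complex^'k::{finite,linorder}^'n1) (Y :: complex^'k::{finite,linorder}^'n2) \<le> M"
proof -
  let ?c = "norm (mat 1 :: complex^'k::{finite,linorder}^'k::{finite,linorder})"
  have "objective \<tau> N B X Y \<le> (\<Sum>l=1..N. (?c * norm (B l) * ?c)\<^sup>2)"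
    if "X \<in> stiefel" "Y \<in> stiefel"
    for X :: "complex^'k::{finite,linorder}^'n1" and Y :: "complex^'k::{finite,linorder}^'n2"
    unfolding objective_def
  proof (intro sum_mono power_mono)
    fix l
    have "norm (bdiag \<tau> (ctranspose X ** B l ** Y)) \<le> norm (ctranspose X ** B l) * norm Y"
      by (intro order.trans[OF norm_bdiag_le] norm_matrix_mult_le)
    also have "\<dots> \<le> norm (ctranspose X) * norm (B l) * norm Y"
      by (intro mult_right_mono norm_matrix_mult_le) simp
    finally show "norm (bdiag \<tau> (ctranspose X ** B l ** Y)) \<le> ?c * norm (B l) * ?c"
      by (simp add: norm_ct norm_stiefel[OF that(1)] norm_stiefel[OF that(2)])
  qed simp
  then show thesis by (rule that)
qed

text \<open>Otherwise the sequence leaves a small ball around \<open>x\<close> infinitely often.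
  Along a subsequence the exit times converge, by isolation to \<open>x\<close>; then some of their
  successors approach \<open>x\<close> too, although all of them lie outside the ball.\<close>

lemma isolated_accumulation_point_imp_limit:
  fixes z :: "nat \<Rightarrow> 'a::metric_space"
  assumes K: "compact K" "\<And>n. z n \<in> K"
    and iso: "x isolated_in {p. accumulation_point z p}"
    and step: "\<And>r. strict_mono r \<Longrightarrow> (\<lambda>i. z (r i)) \<longlonglongrightarrow> x \<Longrightarrow>
      \<exists>s. strict_mono s \<and> (\<lambda>i. z (Suc (r (s i)))) \<longlonglongrightarrow> x"
  shows "z \<longlonglongrightarrow> x"
proof (rule ccontr)
  assume "\<not> z \<longlonglongrightarrow> x"
  then obtain \<epsilon> where \<epsilon>: "\<epsilon> > 0" "\<And>m. \<exists>n\<ge>m. \<epsilon> \<le> dist (z n) x"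
    unfolding lim_sequentially by (meson not_le)
  obtain e where e: "e > 0" "\<And>y. accumulation_point z y \<Longrightarrow> dist x y < e \<Longrightarrow> y = x"
    and acc: "accumulation_point z x"
    using iso unfolding isolated_in_dist_Ex_iff by auto
  \<comment> \<open>The bound \<open>d \<le> \<epsilon>\<close> puts the far iterates outside the
    ball, and \<open>d < e\<close> makes \<open>x\<close> the only accumulation point in the closed
    ball.\<close>
  define d where "d = min \<epsilon> (e / 2)"
  have d: "d > 0" "d \<le> \<epsilon>" "d < e" using \<epsilon> e by (auto simp: d_def)
  obtain r where r: "strict_mono r" "(z \<circ> r) \<longlonglongrightarrow> x"
    using acc by (auto simp: accumulation_point_def)
  have inside: "\<exists>n\<ge>m. dist (z n) x < d" for m
  proof -
    obtain i where i: "\<And>j. j \<ge> i \<Longrightarrow> dist (z (r j)) x < d"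
      using r(2) d(1) unfolding lim_sequentially o_def by blast
    have "m \<le> r (max i m)"
      using seq_suble[OF r(1), of "max i m"] by simp
    then show ?thesis using i[of "max i m"] by auto
  qed
  \<comment> \<open>Without an exit after \<open>m\<close>, induction traps the sequence in the ball
    from \<open>n0\<close> on, against the far iterate \<open>n1\<close>.\<close>
  have exits: "\<exists>n\<ge>m. dist (z n) x < d \<and> d \<le> dist (z (Suc n)) x" for m
  proof (rule ccontr)
    assume stay: "\<not> ?thesis"
    obtain n0 where n0: "n0 \<ge> m" "dist (z n0) x < d" using inside by blast
    obtain n1 where n1: "n1 \<ge> n0" "\<epsilon> \<le> dist (z n1) x" using \<epsilon> by blast
    have "dist (z n1) x < d"
      using n1(1)
    proof (induction n1 rule: dec_induct)
      case (step n)
      then show ?case using stay n0(1) by (meson not_le order.trans)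
    qed (rule n0)
    then show False using n1 d by simp
  qed
  define S where "S = {n. dist (z n) x < d \<and> d \<le> dist (z (Suc n)) x}"
  have "infinite S"
    unfolding infinite_nat_iff_unbounded_le S_def using exits by blast
  obtain q :: "nat \<Rightarrow> nat" where q: "strict_mono q" "\<And>n. q n \<in> S"
    using infinite_enumerate[OF \<open>infinite S\<close>] by blast
  obtain l s where s: "strict_mono s" "((\<lambda>n. z (q n)) \<circ> s) \<longlonglongrightarrow> l"
    using K unfolding compact_def by meson
  have qs: "strict_mono (q \<circ> s)" using q s by (simp add: strict_mono_o)
  have "accumulation_point z l"
    using qs s(2) unfolding accumulation_point_def by (auto simp: o_def)
  moreover have "dist l x \<le> d"
    using s(2) q(2) by (intro Lim_bounded[OF tendsto_dist[OF _ tendsto_const], of _ l 0 x d])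
      (auto simp: o_def S_def intro: less_imp_le)
  ultimately have "l = x" using e(2) d by (simp add: dist_commute)
  then obtain t where t: "strict_mono t" "(\<lambda>i. z (Suc ((q \<circ> s) (t i)))) \<longlonglongrightarrow> x"
    using step[OF qs] s(2) by (auto simp: o_def)
  have "(\<lambda>i. dist (z (Suc (q (s (t i))))) x) \<longlonglongrightarrow> 0"
    using tendsto_dist[OF t(2) tendsto_const[of x]] by (simp add: o_def)
  moreover have "d \<le> dist (z (Suc (q (s (t i))))) x" for i
    using q(2) by (simp add: S_def)
  ultimately have "d \<le> 0" by (intro LIMSEQ_le_const) auto
  then show False using d by simp
qed

subsection \<open>The iteration\<close>

locale npdo =
  fixes \<tau> :: "nat list" and N :: nat and B :: "nat \<Rightarrow> complex^'n2^'n1"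
    and U :: "nat \<Rightarrow> complex^'k::{finite,linorder}^'n1"
    and V :: "nat \<Rightarrow> complex^'k::{finite,linorder}^'n2"
  assumes npdo: "npdo_gauss_seidel \<tau> N B U V"
begin

abbreviation "f j \<equiv> objective \<tau> N B (U j) (V j)"
abbreviation "H1 j \<equiv> grad_U \<tau> N B (U j) (V j)"
abbreviation "H2 j \<equiv> grad_V \<tau> N B (U (Suc j)) (V j)"
abbreviation "gap1 j \<equiv> H1 j \<bullet> U (Suc j) - H1 j \<bullet> U j"
abbreviation "gap2 j \<equiv> H2 j \<bullet> V (Suc j) - H2 j \<bullet> V j"

lemma polar1: "polar_factor (H1 j) (U (Suc j))" and polar2: "polar_factor (H2 j) (V (Suc j))"
  using npdo by (auto simp: npdo_gauss_seidel_def)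

lemma U_stiefel: "U j \<in> stiefel" and V_stiefel: "V j \<in> stiefel"
  using npdo polar1[of "j - 1"] polar2[of "j - 1"]
  by (cases j; simp add: npdo_gauss_seidel_def polar_factor_iff)+

lemma gap1_nonneg: "0 \<le> gap1 j" and gap2_nonneg: "0 \<le> gap2 j"
  using polar_factor_inner_le[OF polar1 U_stiefel, of j j]
    polar_factor_inner_le[OF polar2 V_stiefel, of j j] by simp_all

text \<open>The two tangent inequalities are chained through the intermediate point
  \<open>(U (Suc j), V j)\<close> of the Gauss-Seidel sweep.\<close>

lemma gaps_le: "gap1 j + gap2 j \<le> f (Suc j) - f j"
  using objective_ge_tangent_U[of \<tau> N B "U j" "V j" "U (Suc j)"]
    objective_ge_tangent_V[of \<tau> N B "U (Suc j)" "V j" "V (Suc j)"] by simp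

lemma objective_incseq: "incseq f"
proof (rule incseq_SucI)
  show "f j \<le> f (Suc j)" for j
    using gaps_le[of j] gap1_nonneg[of j] gap2_nonneg[of j] by linarith
qed

lemma objective_convergent: "convergent f"
proof -
  obtain M where M: "\<And>X Y. X \<in> stiefel \<Longrightarrow> Y \<in> stiefel \<Longrightarrow>
      objective \<tau> N B (X :: complex^'k::{finite,linorder}^'n1) (Y :: complex^'k::{finite,linorder}^'n2) \<le> M"
    using objective_bounded[of \<tau> N B] by blast
  have "\<forall>j. f j \<le> M"
    by (intro allI M U_stiefel V_stiefel)
  then obtain l where "f \<longlonglongrightarrow> l"
    using incseq_convergent[OF objective_incseq] by blast
  then show ?thesis by (rule convergentI)
qed

text \<open>The nonnegative gaps are dominated by the increments of \<open>f\<close>, whose series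
  telescopes.\<close>

lemma summable_gaps: "summable gap1" "summable gap2"
proof -
  obtain l where "f \<longlonglongrightarrow> l" using objective_convergent by (auto simp: convergent_def)
  then have s: "summable (\<lambda>j. f (Suc j) - f j)" by (rule telescope_summable)
  have n: "norm (gap1 j) \<le> f (Suc j) - f j" "norm (gap2 j) \<le> f (Suc j) - f j" for j
    unfolding real_norm_def using gaps_le[of j] gap1_nonneg[of j] gap2_nonneg[of j] by linarith+
  show "summable gap1"
    by (rule summable_comparison_test'[where N = 0 and g = "\<lambda>j. f (Suc j) - f j"]) (rule s, rule n)
  show "summable gap2"
    by (rule summable_comparison_test'[where N = 0 and g = "\<lambda>j. f (Suc j) - f j"]) (rule s, rule n)
qed

lemma gaps_subseq_tendsto_0:
  assumes "strict_mono r"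
  shows "(\<lambda>i. gap1 (r i)) \<longlonglongrightarrow> 0" "(\<lambda>i. gap2 (r i)) \<longlonglongrightarrow> 0"
  by (rule LIMSEQ_subseq_LIMSEQ[OF summable_LIMSEQ_zero[OF summable_gaps(1)] assms, unfolded o_def]
      LIMSEQ_subseq_LIMSEQ[OF summable_LIMSEQ_zero[OF summable_gaps(2)] assms, unfolded o_def])+

lemma limit1:
  assumes "strict_mono r" "(\<lambda>i. U (r i)) \<longlonglongrightarrow> Us" "(\<lambda>i. V (r i)) \<longlonglongrightarrow> Vs"
    "(\<lambda>i. U (Suc (r i))) \<longlonglongrightarrow> Uh"
  shows "polar_factor (grad_U \<tau> N B Us Vs) Uh" "Us \<in> stiefel"
    "grad_U \<tau> N B Us Vs \<bullet> Us = grad_U \<tau> N B Us Vs \<bullet> Uh"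
  using polar_factor_limit_inner_eq[OF polar1 U_stiefel tendsto_grad_U[OF assms(2,3)] assms(4,2)
      gaps_subseq_tendsto_0(1)[OF assms(1)]] by blast+

lemma limit2:
  assumes "strict_mono r" "(\<lambda>i. U (Suc (r i))) \<longlonglongrightarrow> Uh" "(\<lambda>i. V (r i)) \<longlonglongrightarrow> Vs"
    "(\<lambda>i. V (Suc (r i))) \<longlonglongrightarrow> Vh"
  shows "polar_factor (grad_V \<tau> N B Uh Vs) Vh" "Vs \<in> stiefel"
    "grad_V \<tau> N B Uh Vs \<bullet> Vs = grad_V \<tau> N B Uh Vs \<bullet> Vh"
  using polar_factor_limit_inner_eq[OF polar2 V_stiefel tendsto_grad_V[OF assms(2,3)] assms(4,3)
      gaps_subseq_tendsto_0(2)[OF assms(1)]] by blast+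

lemma U_convergent_subseq:
  obtains s Uh where "strict_mono (s :: nat \<Rightarrow> nat)" "(\<lambda>i. U (q (s i))) \<longlonglongrightarrow> Uh"
  using compact_stiefel U_stiefel unfolding compact_def o_def
  by (auto dest!: spec[of _ "\<lambda>i. U (q i)"])

lemma V_convergent_subseq:
  obtains s Vh where "strict_mono (s :: nat \<Rightarrow> nat)" "(\<lambda>i. V (q (s i))) \<longlonglongrightarrow> Vh"
  using compact_stiefel V_stiefel unfolding compact_def o_def
  by (auto dest!: spec[of _ "\<lambda>i. V (q i)"])

text \<open>The successors need not converge, so compactness provides a further subsequence on which
  they do. The gap vanishes in the limit, which turns the limit of the old iterates into a polar
  factor, equal to that of the new ones under full rank.\<close>

lemma subseq_polar_equations:
  fixes r :: "nat \<Rightarrow> nat"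
  assumes r: "strict_mono r" and U: "(\<lambda>i. U (r i)) \<longlonglongrightarrow> Us" and V: "(\<lambda>i. V (r i)) \<longlonglongrightarrow> Vs"
  shows "polar_equation (grad_U \<tau> N B Us Vs) Us"
    and "accumulation_point (\<lambda>i. U (Suc (r i))) Uh \<Longrightarrow> polar_equation (grad_V \<tau> N B Uh Vs) Vs"
    and "accumulation_point (\<lambda>i. U (Suc (r i))) Uh \<Longrightarrow> rank (grad_U \<tau> N B Us Vs) = CARD('k) \<Longrightarrow> Uh = Us"
proof -
  have sub: "(\<lambda>i. U (r (s i))) \<longlonglongrightarrow> Us" "(\<lambda>i. V (r (s i))) \<longlonglongrightarrow> Vs" "strict_mono (\<lambda>i. r (s i))"
    if "strict_mono s" for s :: "nat \<Rightarrow> nat"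
    using LIMSEQ_subseq_LIMSEQ[OF U that] LIMSEQ_subseq_LIMSEQ[OF V that] strict_mono_o[OF r that]
    by (simp_all add: o_def)
  show "polar_equation (grad_U \<tau> N B Us Vs) Us"
  proof -
    obtain s Uh where "strict_mono s" "(\<lambda>i. U (Suc (r (s i)))) \<longlonglongrightarrow> Uh"
      by (rule U_convergent_subseq[of "\<lambda>i. Suc (r i)"])
    then show ?thesis
      using limit1[OF sub(3,1,2)] polar_factor_inner_eq(1) by blast
  qed
  assume "accumulation_point (\<lambda>i. U (Suc (r i))) Uh"
  then obtain s where s: "strict_mono s" and Uh: "(\<lambda>i. U (Suc (r (s i)))) \<longlonglongrightarrow> Uh"
    by (auto simp: accumulation_point_def o_def)
  show "polar_equation (grad_V \<tau> N B Uh Vs) Vs"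
  proof -
    obtain t Vh where t: "strict_mono t" and Vh: "(\<lambda>i. V (Suc (r (s (t i))))) \<longlonglongrightarrow> Vh"
      by (rule V_convergent_subseq[of "\<lambda>i. Suc (r (s i))"])
    have "strict_mono (\<lambda>i. s (t i))" using strict_mono_o[OF s t] by (simp add: o_def)
    note st = sub[OF this]
    have "(\<lambda>i. U (Suc (r (s (t i))))) \<longlonglongrightarrow> Uh"
      using LIMSEQ_subseq_LIMSEQ[OF Uh t] by (simp add: o_def)
    from limit2[OF st(3) this st(2) Vh] show ?thesis
      using polar_factor_inner_eq(1) by blast
  qed
  assume "rank (grad_U \<tau> N B Us Vs) = CARD('k)"
  then show "Uh = Us"
    using limit1[OF sub(3,1,2)[OF s] Uh] polar_factor_full_rank_unique by blast
qed

text \<open>The order matters: full rank of the first gradient gives \<open>Uh = Us\<close>, and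
  only then is the second gradient evaluated at \<open>(Us, Vs)\<close>, where its rank is
  known.\<close>

lemma step_tendsto:
  fixes r :: "nat \<Rightarrow> nat"
  assumes r: "strict_mono r" and lim: "(\<lambda>i. (U (r i), V (r i))) \<longlonglongrightarrow> (Us, Vs)"
    and rank: "rank (grad_U \<tau> N B Us Vs) = CARD('k)" "rank (grad_V \<tau> N B Us Vs) = CARD('k)"
  shows "\<exists>s. strict_mono s \<and> (\<lambda>i. (U (Suc (r (s i))), V (Suc (r (s i))))) \<longlonglongrightarrow> (Us, Vs)"
proof -
  have U: "(\<lambda>i. U (r i)) \<longlonglongrightarrow> Us" and V: "(\<lambda>i. V (r i)) \<longlonglongrightarrow> Vs"
    using tendsto_fst[OF lim] tendsto_snd[OF lim] by simp_all
  obtain s Uh where s: "strict_mono s" and Uh: "(\<lambda>i. U (Suc (r (s i)))) \<longlonglongrightarrow> Uh"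
    by (rule U_convergent_subseq[of "\<lambda>i. Suc (r i)"])
  obtain t Vh where t: "strict_mono t" and Vh: "(\<lambda>i. V (Suc (r (s (t i))))) \<longlonglongrightarrow> Vh"
    by (rule V_convergent_subseq[of "\<lambda>i. Suc (r (s i))"])
  have "accumulation_point (\<lambda>i. U (Suc (r i))) Uh"
    using s Uh by (auto simp: accumulation_point_def o_def)
  then have "Uh = Us"
    using subseq_polar_equations(3)[OF r U V] rank by blast
  then have U': "(\<lambda>i. U (Suc (r (s (t i))))) \<longlonglongrightarrow> Us"
    using LIMSEQ_subseq_LIMSEQ[OF Uh t] by (simp add: o_def)
  have st: "strict_mono (s \<circ> t)" by (rule strict_mono_o[OF s t])
  have "strict_mono (\<lambda>i. r (s (t i)))" "(\<lambda>i. V (r (s (t i)))) \<longlonglongrightarrow> Vs"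
    using strict_mono_o[OF r st] LIMSEQ_subseq_LIMSEQ[OF V st] by (simp_all add: o_def)
  from limit2[OF this(1) U' this(2) Vh] have "Vh = Vs"
    using polar_factor_full_rank_unique rank by blast
  then have "(\<lambda>i. (U (Suc (r ((s \<circ> t) i))), V (Suc (r ((s \<circ> t) i))))) \<longlonglongrightarrow> (Us, Vs)"
    using tendsto_Pair[OF U' Vh] by (simp add: o_def)
  with st show ?thesis by blast
qed

lemma isolated_imp_limit:
  assumes "(Us, Vs) isolated_in {p. accumulation_point (\<lambda>j. (U j, V j)) p}"
    and "rank (grad_U \<tau> N B Us Vs) = CARD('k)" "rank (grad_V \<tau> N B Us Vs) = CARD('k)"
  shows "(\<lambda>j. (U j, V j)) \<longlonglongrightarrow> (Us, Vs)"
proof (rule isolated_accumulation_point_imp_limit[OF _ _ assms(1)])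
  show "compact ((stiefel :: (complex^'k::{finite,linorder}^'n1) set) \<times>
      (stiefel :: (complex^'k::{finite,linorder}^'n2) set))"
    by (intro compact_Times compact_stiefel)
  show "(U n, V n) \<in> stiefel \<times> stiefel" for n
    by (simp add: U_stiefel V_stiefel)
qed (rule step_tendsto[OF _ _ assms(2,3)])

end

section \<open>Summability and assembly of the statements\<close>

text \<open>Common pattern of the four series: \<open>a j\<close> is a squared norm of sines or a
  squared relative residual, and \<open>2 * C\<close> times the gap dominates the term.\<close>

lemma polar_series_summable:
  fixes P Q H :: "nat \<Rightarrow> complex^'k^'n"
  assumes k: "CARD('k) \<le> CARD('n)"
    and pf: "\<And>j. polar_factor (H j) (P j)" and Q: "\<And>j. Q j \<in> stiefel"
    and gap: "summable (\<lambda>j. H j \<bullet> P j - H j \<bullet> Q j)"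
    and a: "\<And>j. 0 \<le> a j" "\<And>j. a j \<le> C * (norm (P j - Q j))\<^sup>2" and C: "0 \<le> C"
  shows "summable (\<lambda>j. sigma_min (H j) * a j)"
proof (rule summable_comparison_test'[OF summable_mult[OF gap, of "2 * C"]])
  fix j
  have "sigma_min (H j) * a j \<le> sigma_min (H j) * (C * (norm (P j - Q j))\<^sup>2)"
    by (intro mult_left_mono a sigma_min_nonneg k)
  also have "\<dots> \<le> 2 * C * (H j \<bullet> P j - H j \<bullet> Q j)"
    using mult_left_mono[OF polar_factor_gap_sigma_min[OF k pf Q] C, of j j] by (simp add: mult_ac)
  finally show "norm (sigma_min (H j) * a j) \<le> 2 * C * (H j \<bullet> P j - H j \<bullet> Q j)"
    using a(1) sigma_min_nonneg[OF k] by simp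
qed

theorem theorem4p1:
  fixes B :: "nat \<Rightarrow> complex^'n2^'n1"
    and N :: nat
    and \<tau> :: "nat list"
    and U :: "nat \<Rightarrow> complex^'k::{finite,linorder}^'n1"
    and V :: "nat \<Rightarrow> complex^'k::{finite,linorder}^'n2"
  assumes "partition_of \<tau> CARD('k)"
    and "CARD('k) \<le> min CARD('n1) CARD('n2)"
    and "npdo_gauss_seidel \<tau> N B U V"
  defines "f \<equiv> objective \<tau> N B"
    and "H1 \<equiv> grad_U \<tau> N B"
    and "H2 \<equiv> grad_V \<tau> N B"
  defines "star \<equiv> \<lambda>Us Vs. polar_equation (H1 Us Vs) Us \<and> polar_equation (H2 Us Vs) Vs"
    and "H1s \<equiv> \<lambda>j. H1 (U j) (V j)"
    and "H2s \<equiv> \<lambda>j. H2 (U (Suc j)) (V j)"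
  shows "
     \<comment> \<open>(a)\<close>
     (incseq (\<lambda>j. f (U j) (V j)) \<and> convergent (\<lambda>j. f (U j) (V j))) \<and>
     \<comment> \<open>(b)\<close>
     (\<forall>Us Vs (r::nat \<Rightarrow> nat).
       accumulation_point (\<lambda>j. (U j, V j)) (Us, Vs) \<and>
       strict_mono r \<and> (\<lambda>i. (U (r i), V (r i))) \<longlonglongrightarrow> (Us, Vs) \<longrightarrow>
         polar_equation (H1 Us Vs) Us \<and>
         (\<forall>Uh. accumulation_point (\<lambda>i. U (Suc (r i))) Uh \<longrightarrow>
            polar_equation (H2 Uh Vs) Vs \<and> (Uh = Us \<longrightarrow> star Us Vs))) \<and>
     \<comment> \<open>(c)\<close>
     (\<forall>Us Vs (r::nat \<Rightarrow> nat).
       accumulation_point (\<lambda>j. (U j, V j)) (Us, Vs) \<and>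
       strict_mono r \<and> (\<lambda>i. (U (r i), V (r i))) \<longlonglongrightarrow> (Us, Vs) \<and>
       rank (H1 Us Vs) = CARD('k) \<longrightarrow>
         (\<forall>Uh. accumulation_point (\<lambda>i. U (Suc (r i))) Uh \<longrightarrow> Uh = Us) \<and> star Us Vs) \<and>
     \<comment> \<open>(d)\<close>
     (\<forall>Us Vs.
       (Us, Vs) isolated_in {p. accumulation_point (\<lambda>j. (U j, V j)) p} \<and>
       rank (H1 Us Vs) = CARD('k) \<and> rank (H2 Us Vs) = CARD('k) \<longrightarrow>
         (\<lambda>j. (U j, V j)) \<longlonglongrightarrow> (Us, Vs)) \<and>
     \<comment> \<open>(e); for H = 0 the factor sigma_min H is 0, and so is the whole term\<close>
     (summable (\<lambda>j. sigma_min (H1s j) *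
       (norm (sin_diag (canonical_angles (col_space (U (Suc j))) (col_space (U j)) :: real^'k::{finite,linorder}^'k::{finite,linorder})))\<^sup>2)) \<and>
     (summable (\<lambda>j. sigma_min (H2s j) *
       (norm (sin_diag (canonical_angles (col_space (V (Suc j))) (col_space (V j)) :: real^'k::{finite,linorder}^'k::{finite,linorder})))\<^sup>2)) \<and>
     (summable (\<lambda>j. sigma_min (H1s j) *
       ((norm (H1s j - U j ** (ctranspose (U j) ** H1s j)))\<^sup>2 / (norm (H1s j))\<^sup>2))) \<and>
     (summable (\<lambda>j. sigma_min (H2s j) *
       ((norm (H2s j - V j ** (ctranspose (V j) ** H2s j)))\<^sup>2 / (norm (H2s j))\<^sup>2)))"
proof -
  interpret npdo \<tau> N B U V by (unfold_locales) (rule assms(3))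
  have k: "CARD('k) \<le> CARD('n1)" "CARD('k) \<le> CARD('n2)" using assms(2) by simp_all
  have b: "polar_equation (H1 Us Vs) Us"
    "accumulation_point (\<lambda>i. U (Suc (r i))) Uh \<Longrightarrow> polar_equation (H2 Uh Vs) Vs"
    "accumulation_point (\<lambda>i. U (Suc (r i))) Uh \<Longrightarrow> rank (H1 Us Vs) = CARD('k) \<Longrightarrow> Uh = Us"
    if "strict_mono r" "(\<lambda>i. (U (r i), V (r i))) \<longlonglongrightarrow> (Us, Vs)" for r :: "nat \<Rightarrow> nat" and Us Vs Uh
    using subseq_polar_equations[OF that(1) tendsto_fst[OF that(2), simplified]
        tendsto_snd[OF that(2), simplified]] unfolding H1_def H2_def by blast+
  \<comment> \<open>Claim (c) asserts \<open>star Us Vs\<close> without naming any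
    \<open>Uh\<close>, so an accumulation point of the successors has to be exhibited.\<close>
  have acc: "\<exists>Uh. accumulation_point (\<lambda>i. U (Suc (r i))) Uh" for r :: "nat \<Rightarrow> nat"
    by (rule U_convergent_subseq[of "\<lambda>i. Suc (r i)"]) (auto simp: accumulation_point_def o_def)
  note series1 = polar_series_summable[OF k(1) polar1 U_stiefel summable_gaps(1)]
  note series2 = polar_series_summable[OF k(2) polar2 V_stiefel summable_gaps(2)]
  show ?thesis
    unfolding H1s_def H2s_def
  proof (intro conjI allI impI; (elim conjE)?)
    show "incseq (\<lambda>j. f (U j) (V j))" "convergent (\<lambda>j. f (U j) (V j))"
      unfolding f_def by (rule objective_incseq objective_convergent)+
  next
    fix Us Vs Uh and r :: "nat \<Rightarrow> nat"
    assume "strict_mono r" "(\<lambda>i. (U (r i), V (r i))) \<longlonglongrightarrow> (Us, Vs)"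
    note b = b[OF this]
    show "polar_equation (H1 Us Vs) Us" by (rule b)
    assume Uh: "accumulation_point (\<lambda>i. U (Suc (r i))) Uh"
    show "polar_equation (H2 Uh Vs) Vs" by (rule b(2)[OF Uh])
    show "star Us Vs" if "Uh = Us"
      using b(1) b(2)[OF Uh] that by (simp add: star_def)
    show "Uh = Us" if "rank (H1 Us Vs) = CARD('k)" by (rule b(3)[OF Uh that])
  next
    fix Us Vs and r :: "nat \<Rightarrow> nat"
    assume "strict_mono r" "(\<lambda>i. (U (r i), V (r i))) \<longlonglongrightarrow> (Us, Vs)" and rank: "rank (H1 Us Vs) = CARD('k)"
    note b = b[OF this(1,2)]
    obtain Uh where Uh: "accumulation_point (\<lambda>i. U (Suc (r i))) Uh"
      using acc by blast
    have "Uh = Us" by (rule b(3)[OF Uh rank])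
    then show "star Us Vs"
      using b(1) b(2)[OF Uh] by (simp add: star_def)
  next
    fix Us Vs
    assume "(Us, Vs) isolated_in {p. accumulation_point (\<lambda>j. (U j, V j)) p}"
      "rank (H1 Us Vs) = CARD('k)" "rank (H2 Us Vs) = CARD('k)"
    then show "(\<lambda>j. (U j, V j)) \<longlonglongrightarrow> (Us, Vs)"
      unfolding H1_def H2_def by (rule isolated_imp_limit)
  \<comment> \<open>The four series remain: \<open>C\<close> is \<open>CARD('k)\<close> for the
    sines and \<open>1\<close> for the relative residuals.\<close>
  qed (unfold H1_def H2_def,
      (rule series1 series2,
        simp, rule norm_sin_canonical_angles_le[OF U_stiefel U_stiefel]
          norm_sin_canonical_angles_le[OF V_stiefel V_stiefel], simp)+,
      (rule series1[where C = 1] series2[where C = 1], simp,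
        simp add: polar_factor_residual_le[OF polar1 U_stiefel] polar_factor_residual_le[OF polar2 V_stiefel], simp)+)
qed

end
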